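(* Let $V=(V,Y,\mathbf 1,\omega)$ be a vertex operator algebra over $\mathbb C$. Then for all $u_1,v_1,u_2,v_2\in V$, with $x_1,x_2,y_1,y_2,w_1,w_2,w$ commuting formal variables, $$\begin{aligned} &[X(Y[u_1,y_1]v_1,e^{w_1}x_1),\,X(Y[u_2,y_2]v_2,e^{w_2}x_2)]\\ &=\mathrm{Res}_{w}\,\delta\!\left(e^{-w}\frac{e^{w_1}x_1}{e^{w_2}x_2}\right)X\bigl(Y[Y[u_1,y_1]v_1,w]\,Y[u_2,y_2]v_2,\;e^{w_2}x_2\bigr). \end{aligned}$$
   Context: A vertex operator algebra $(V,Y,\mathbf 1,\omega)$ over $\mathbb C$ is a $\mathbb Z$-graded vector space $V=\coprod_{n\in\mathbb Z}V_{(n)}$ (write $\mathrm{wt}\,v=n$ for $v\in V_{(n)}$) with $\dim V_{(n)}<\infty$ for all $n$ and $V_{(n)}=0$ for $n$ sufficiently small (i.e. sufficiently negative), a linear map $V\to(\mathrm{End}\,V)[[x,x^{-1}]]$, $v\mapsto Y(v,x)=\sum_{n\in\mathbb Z}v_nx^{-n-1}$, and homogeneous vectors $\mathbf 1\in V_{(0)}$, $\omega\in V_{(2)}$, such that for $u,v\in V$: $u_nv=0$ for $n$ sufficiently large; $Y(\mathbf 1,x)=1$; $Y(v,x)\mathbf 1\in V[[x]]$ with constant term $v$; the Jacobi identity $$x_0^{-1}\delta\!\left(\tfrac{x_1-x_2}{x_0}\right)Y(u,x_1)Y(v,x_2)-x_0^{-1}\delta\!\left(\tfrac{x_2-x_1}{-x_0}\right)Y(v,x_2)Y(u,x_1)=x_2^{-1}\delta\!\left(\tfrac{x_1-x_0}{x_2}\right)Y(Y(u,x_0)v,x_2)$$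 holds (binomial expressions expanded in nonnegative powers of the second variable); writing $Y(\omega,x)=\sum_{n}L(n)x^{-n-2}$, one has $[L(m),L(n)]=(m-n)L(m+n)+\frac1{12}(m^3-m)\delta_{m+n,0}(\mathrm{rank}\,V)$ for some $\mathrm{rank}\,V\in\mathbb C$; $L(0)v=nv$ for $v\in V_{(n)}$; and $\frac{d}{dx}Y(v,x)=Y(L(-1)v,x)$. Here $\delta(x)=\sum_{n\in\mathbb Z}x^n$. For $v\in V$, $X(v,x)=Y(x^{L(0)}v,x)$, i.e. $X(v,x)=x^{\mathrm{wt}\,v}Y(v,x)$ for homogeneous $v$, extended linearly. For $u\in V$, $Y[u,y]=Y(e^{yL(0)}u,e^{y}-1)$, where powers $(e^y-1)^{n}$, $n\in\mathbb Z$, are expanded as formal Laurent series in $y$ with finitely many negative powers, so $Y[u,y]v\in V((y))$. The maps $X(\cdot,x)$ and $Y[\cdot,y]$ are extended coefficientwise to formal series with coefficients in $V$. Substituting $e^{w}x$ for $x$ means replacing $x^n$ by $e^{nw}x^n$, and all exponentials $e^{nw}$ are expanded in nonnegative powers of the exponent variables (also inside $\delta$). $\mathrm{Res}_w$ denotes the coefficient of $w^{-1}$. *)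

theory Defs
  imports
    Complex_Main
    "HOL-Library.Function_Algebras"
    "HOL-Library.Groups_Big_Fun"
    "HOL-Computational_Algebra.Formal_Laurent_Series"
begin

section \<open>Formal series in several variables\<close>

datatype fvar = X0 | X1 | X2 | Y1 | Y2 | W | W1 | W2

text \<open>
  A series maps the exponent vector of a Laurent monomial to its coefficient; no support
  condition is imposed, so exponents may be unbounded in both directions.
  Exponent vectors are added and subtracted pointwise.

  All sums over indices are \<^const>\<open>Sum_any\<close>, the sum of a family with finite support (and 0
  otherwise). This is the usual convention of formal calculus that a product or substitution
  exists if every coefficient is a finite sum. In a vertex operator algebra the lower
  truncation condition makes all the sums below finite. Operator-valued series
  are always applied to a vector, because their sums are finite only after application.
\<close>

type_synonym 'a fser = "(fvar \<Rightarrow> int) \<Rightarrow> 'a"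

definition expo :: "fvar \<Rightarrow> int \<Rightarrow> fvar \<Rightarrow> int" where
  "expo x k = (\<lambda>_. 0)(x := k)"

definition fconst :: "'a::zero \<Rightarrow> 'a fser" where
  "fconst a = (\<lambda>e. if e = 0 then a else 0)"

text \<open>The power \<open>(c x)\<^sup>k\<close>.\<close>
definition fmono :: "complex \<Rightarrow> fvar \<Rightarrow> int \<Rightarrow> complex fser" where
  "fmono c x k = (\<lambda>e. if e = expo x k then c powi k else 0)"

definition of_fls :: "fvar \<Rightarrow> complex fls \<Rightarrow> complex fser" where
  "of_fls x F = (\<lambda>e. if e = expo x (e x) then fls_nth F (e x) else 0)"

text \<open>The power \<open>(x - y)\<^sup>n\<close> of distinct variables, expanded in nonnegative powers of \<open>y\<close>.\<close>
definition fdiff_pow :: "fvar \<Rightarrow> fvar \<Rightarrow> int \<Rightarrow> complex fser" where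
  "fdiff_pow x y n =
     (\<lambda>e. if e y \<ge> 0 \<and> e = expo x (n - e y) + expo y (e y)
          then (- 1) ^ nat (e y) * (of_int n gchoose nat (e y)) else 0)"

definition fconv :: "('a \<Rightarrow> 'b \<Rightarrow> 'c::comm_monoid_add) \<Rightarrow> 'a fser \<Rightarrow> 'b fser \<Rightarrow> 'c fser" where
  "fconv m f g = (\<lambda>e. Sum_any (\<lambda>d. m (f d) (g (e - d))))"

abbreviation fmult :: "complex fser \<Rightarrow> complex fser \<Rightarrow> complex fser" where
  "fmult \<equiv> fconv (*)"

text \<open>
  Substitution into the one-variable series with coefficients \<open>f\<close>; \<open>p k\<close> is the
  expansion of the \<open>k\<close>-th power of the expression that is substituted.
\<close>
definition fsubst ::
  "(complex \<Rightarrow> 'a \<Rightarrow> 'a::comm_monoid_add) \<Rightarrow> (int \<Rightarrow> complex fser) \<Rightarrow> (int \<Rightarrow> 'a) \<Rightarrow> 'a fser" where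
  "fsubst s p f = (\<lambda>e. Sum_any (\<lambda>k. s (p k e) (f k)))"

definition fdelta :: "(int \<Rightarrow> complex fser) \<Rightarrow> complex fser" where
  "fdelta p = fsubst (*) p (\<lambda>_. 1)"

text \<open>Coefficientwise extension of a series-valued bilinear operation to series arguments.\<close>
definition fext :: "('a \<Rightarrow> 'b \<Rightarrow> 'c::comm_monoid_add fser) \<Rightarrow> 'a fser \<Rightarrow> 'b fser \<Rightarrow> 'c fser" where
  "fext F f g = (\<lambda>e. Sum_any (\<lambda>(d, d'). F (f d) (g d') (e - d - d')))"

definition fres :: "fvar \<Rightarrow> 'a::zero fser \<Rightarrow> 'a fser" where
  "fres x f = (\<lambda>e. if e x = 0 then f (e(x := - 1)) else 0)"

definition fcommutator ::
  "('a fser \<Rightarrow> 'a fser) \<Rightarrow> ('a fser \<Rightarrow> 'a fser) \<Rightarrow> 'a fser \<Rightarrow> 'a::ab_group_add fser" where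
  "fcommutator S T = (\<lambda>f. S (T f) - T (S f))"

text \<open>The series \<open>e\<^bsup>cw\<^esup>\<close>.\<close>
definition fexp :: "complex \<Rightarrow> fvar \<Rightarrow> complex fser" where
  "fexp c w = of_fls w (fps_to_fls (fps_exp c))"

text \<open>The powers \<open>(e\<^sup>w x)\<^sup>k\<close>.\<close>
definition exp_times :: "fvar \<Rightarrow> fvar \<Rightarrow> int \<Rightarrow> complex fser" where
  "exp_times w x k = fmult (fexp (of_int k) w) (fmono 1 x k)"

text \<open>The powers \<open>(e\<^sup>y - 1)\<^sup>k\<close>.\<close>
definition exp_minus_one :: "fvar \<Rightarrow> int \<Rightarrow> complex fser" where
  "exp_minus_one y k = of_fls y ((fps_to_fls (fps_exp 1) - 1) powi k)"


section \<open>Vertex operator algebras\<close>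

text \<open>
  The underlying vector space is the whole type \<open>'v\<close> with scalar multiplication \<open>scal\<close>,
  and \<open>mode V u n z\<close> is \<open>u\<^sub>n z\<close>.
\<close>
record 'v vertex_data =
  scal :: "complex \<Rightarrow> 'v \<Rightarrow> 'v"
  grade :: "int \<Rightarrow> 'v set"
  mode :: "'v \<Rightarrow> int \<Rightarrow> 'v \<Rightarrow> 'v"
  vac :: 'v
  conf :: 'v

text \<open>The coefficient of \<open>x\<^sup>k\<close> in \<open>Y(u, x) z\<close>.\<close>
definition Ycoeff :: "'v vertex_data \<Rightarrow> 'v \<Rightarrow> 'v \<Rightarrow> int \<Rightarrow> 'v" where
  "Ycoeff V u z k = mode V u (- k - 1) z"

text \<open>\<open>Y(u, t) z\<close>, where \<open>p\<close> is the family of powers of \<open>t\<close>.\<close>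
definition Yop ::
  "'v::ab_group_add vertex_data \<Rightarrow> (int \<Rightarrow> complex fser) \<Rightarrow> 'v \<Rightarrow> 'v \<Rightarrow> 'v fser" where
  "Yop V p u z = fsubst (scal V) p (Ycoeff V u z)"

definition Lop :: "'v vertex_data \<Rightarrow> int \<Rightarrow> 'v \<Rightarrow> 'v" where
  "Lop V n = mode V (conf V) (n + 1)"

definition is_decomp :: "'v::ab_group_add vertex_data \<Rightarrow> 'v \<Rightarrow> (int \<Rightarrow> 'v) \<Rightarrow> bool" where
  "is_decomp V v f \<longleftrightarrow> (\<forall>n. f n \<in> grade V n) \<and> finite {n. f n \<noteq> 0} \<and> v = Sum_any f"

definition hcomp :: "'v::ab_group_add vertex_data \<Rightarrow> 'v \<Rightarrow> int \<Rightarrow> 'v" where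
  "hcomp V v = (THE f. is_decomp V v f)"

locale vertex_operator_algebra =
  vector_space "scal V" for V :: "'v::ab_group_add vertex_data" +
  assumes grade_subspace: "subspace (grade V n)"
    and direct_sum: "\<exists>!f. is_decomp V v f"
    and grade_finite_dim: "\<exists>B. finite B \<and> grade V n = span B"
    and grade_lower_bound: "\<exists>N. \<forall>n<N. grade V n = {0}"
    and mode_linear_left: "Vector_Spaces.linear (scal V) (scal V) (\<lambda>u. mode V u n z)"
    and mode_linear_right: "Vector_Spaces.linear (scal V) (scal V) (\<lambda>z. mode V u n z)"
    and vac_grade: "vac V \<in> grade V 0"
    and conf_grade: "conf V \<in> grade V 2"
    and truncation: "\<exists>N. \<forall>n\<ge>N. mode V u n v = 0"
    and vacuum: "mode V (vac V) n v = (if n = - 1 then v else 0)"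
    and creation_regular: "n \<ge> 0 \<Longrightarrow> mode V v n (vac V) = 0"
    and creation: "mode V v (- 1) (vac V) = v"
    and jacobi:
      "fconv (scal V)
         (fmult (fmono 1 X0 (- 1))
           (fdelta (\<lambda>n. fmult (fdiff_pow X1 X2 n) (fmono 1 X0 (- n)))))
         (fext (Yop V (fmono 1 X1)) (fconst u)
           (fext (Yop V (fmono 1 X2)) (fconst v) (fconst z)))
     - fconv (scal V)
         (fmult (fmono 1 X0 (- 1))
           (fdelta (\<lambda>n. fmult (fdiff_pow X2 X1 n) (fmono (- 1) X0 (- n)))))
         (fext (Yop V (fmono 1 X2)) (fconst v)
           (fext (Yop V (fmono 1 X1)) (fconst u) (fconst z)))
     = fconv (scal V)
         (fmult (fmono 1 X2 (- 1))
           (fdelta (\<lambda>n. fmult (fdiff_pow X1 X0 n) (fmono 1 X2 (- n)))))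
         (fext (Yop V (fmono 1 X2))
           (fext (Yop V (fmono 1 X0)) (fconst u) (fconst v)) (fconst z))"
    and virasoro:
      "\<exists>rank. \<forall>m n v. Lop V m (Lop V n v) - Lop V n (Lop V m v) =
         scal V (of_int (m - n)) (Lop V (m + n) v)
         + scal V (1 / 12 * of_int (m ^ 3 - m) * (if m + n = 0 then 1 else 0) * rank) v"
    and L0_grade: "v \<in> grade V n \<Longrightarrow> Lop V 0 v = scal V (of_int n) v"
    and derivative:
      "scal V (of_int (k + 1)) (Ycoeff V v z (k + 1)) = Ycoeff V (Lop V (- 1) v) z k"

text \<open>
  The coefficient of \<open>x\<^sup>k\<close> in \<open>X(u, x) z\<close>, which is the sum over \<open>n\<close> of the
  series \<open>x\<^sup>n Y(u\<^bsub>(n)\<^esub>, x) z\<close> for the homogeneous components \<open>u\<^bsub>(n)\<^esub>\<close> of \<open>u\<close>.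
\<close>
definition Xcoeff :: "'v::ab_group_add vertex_data \<Rightarrow> 'v \<Rightarrow> 'v \<Rightarrow> int \<Rightarrow> 'v" where
  "Xcoeff V u z k = Sum_any (\<lambda>n. Ycoeff V (hcomp V u n) z (k - n))"

definition Xop ::
  "'v::ab_group_add vertex_data \<Rightarrow> (int \<Rightarrow> complex fser) \<Rightarrow> 'v \<Rightarrow> 'v \<Rightarrow> 'v fser" where
  "Xop V p u z = fsubst (scal V) p (Xcoeff V u z)"

text \<open>The series \<open>e\<^bsup>yL(0)\<^esup> u\<close>.\<close>
definition exp_L0 :: "'v::ab_group_add vertex_data \<Rightarrow> fvar \<Rightarrow> 'v \<Rightarrow> 'v fser" where
  "exp_L0 V y u =
     (\<lambda>e. if e y \<ge> 0 \<and> e = expo y (e y)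
          then scal V (1 / fact (nat (e y))) ((Lop V 0 ^^ nat (e y)) u) else 0)"

text \<open>The series \<open>Y[u, y] v\<close>.\<close>
definition Ybracket :: "'v::ab_group_add vertex_data \<Rightarrow> fvar \<Rightarrow> 'v \<Rightarrow> 'v \<Rightarrow> 'v fser" where
  "Ybracket V y u v = fext (Yop V (exp_minus_one y)) (exp_L0 V y u) (fconst v)"

end

theory Submission
  imports Defs
begin

text \<open>
  Both sides are compared coefficient by coefficient. The variables on the left occur in
  disjoint groups: \<open>Y1\<close> and \<open>Y2\<close> only select coefficients \<open>a\<close> of \<open>Y[u\<^sub>1, y\<^sub>1]v\<^sub>1\<close> and \<open>b\<close> of
  \<open>Y[u\<^sub>2, y\<^sub>2]v\<^sub>2\<close>, and \<open>W1\<close>, \<open>W2\<close> only contribute scalars \<open>m\<^sup>i / i!\<close>, where \<open>m\<close> is the exponent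
  of \<open>X1\<close> or \<open>X2\<close>. On the right the exponent \<open>m\<close> of \<open>X1\<close> is also the summation index of the
  delta series, which contributes \<open>e\<^bsup>-mw\<^esup>\<close>; the scalar attached to \<open>W2\<close> is a convolution of two
  exponentials and collapses by the binomial theorem. Writing \<open>X\<^sub>k(a)\<close> for the coefficient of
  \<open>x\<^sup>k\<close> in \<open>X(a, x)\<close>, the theorem becomes the identity
    \<open>[X\<^sub>m(a), X\<^sub>n(b)] = X\<^bsub>m+n\<^esub>(Res\<^sub>w e\<^bsup>-mw\<^esup> Y[a, w] b)\<close>
  for all vectors \<open>a\<close>, \<open>b\<close> and integers \<open>m\<close>, \<open>n\<close> (lemma \<open>Xcoeff_commutator\<close>).

  Both sides of this identity are bilinear, so \<open>a\<close> and \<open>b\<close> may be taken homogeneous of weights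
  \<open>p\<close> and \<open>q\<close>. Then \<open>X\<^sub>m(a)\<close> is the mode \<open>a\<^bsub>p-1-m\<^esub>\<close>, and taking the residue in \<open>x\<^sub>0\<close> of the
  Jacobi identity gives (lemma \<open>mode_commutator\<close>)
    \<open>[a\<^bsub>p-1-m\<^esub>, b\<^bsub>q-1-n\<^esub>] = \<Sum>\<^sub>i (p-1-m gchoose i) (a\<^sub>i b)\<^bsub>p+q-2-m-n-i\<^esub>\<close>.
  The vector \<open>a\<^sub>i b\<close> has weight \<open>p + q - i - 1\<close> (lemma \<open>mode_in_grade\<close>), so its mode on the right
  is \<open>X\<^bsub>m+n\<^esub>(a\<^sub>i b)\<close>. It remains to see that the coefficient of \<open>a\<^sub>i b\<close> in the residue,
  \<open>Res\<^sub>w e\<^bsup>(p-m)w\<^esup> (e\<^sup>w - 1)\<^bsup>-i-1\<^esup>\<close>, is the same binomial coefficient; this is the change of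
  variable \<open>x = e\<^sup>w - 1\<close>, which turns it into \<open>Res\<^sub>x (1 + x)\<^bsup>p-m-1\<^esup> x\<^bsup>-i-1\<^esup>\<close>
  (lemma \<open>residue_exp_minus_one\<close>).

  Since a family with infinite support has sum \<open>0\<close>, additivity of a sum is available only
  where the support is finite. Homogeneous decompositions are finite, and for the other
  sums finiteness comes from lower truncation; in
  \<open>e\<^bsup>yL(0)\<^esup> u\<close>, where infinitely many vectors \<open>L(0)\<^sup>j u\<close> occur, the bound must not depend on \<open>j\<close>
  (lemma \<open>exp_L0_truncation\<close>).
\<close>

section \<open>Formal series in disjoint sets of variables\<close>

text \<open>The support is the image of the support of the composition, so this also holds when
  it is infinite and both sums are \<open>0\<close>.\<close>
lemma Sum_any_reindex:
  assumes "inj \<phi>" and "\<And>d. d \<notin> range \<phi> \<Longrightarrow> f d = 0"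
  shows "Sum_any f = Sum_any (\<lambda>t. f (\<phi> t))"
proof -
  have "{d. f d \<noteq> 0} = \<phi> ` {t. f (\<phi> t) \<noteq> 0}"
  proof (intro equalityI subsetI)
    fix d assume "d \<in> {d. f d \<noteq> 0}"
    then have nz: "f d \<noteq> 0" by simp
    with assms(2) obtain t where "d = \<phi> t" by (metis rangeE)
    with nz show "d \<in> \<phi> ` {t. f (\<phi> t) \<noteq> 0}" by auto
  qed auto
  then show ?thesis
    using assms(1) by (simp add: Sum_any.expand_set sum.reindex inj_on_def)
qed

lemma Sum_any_single:
  assumes "\<And>d. d \<noteq> d0 \<Longrightarrow> f d = 0"
  shows "Sum_any f = f d0"
  using Sum_any.expand_superset[of "{d0}" f] assms by auto

lemma Sum_any_prod:
  assumes "finite A" "finite B" "\<And>a b. f a b \<noteq> 0 \<Longrightarrow> a \<in> A \<and> b \<in> B"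
  shows "Sum_any (\<lambda>(a, b). f a b) = (\<Sum>a\<in>A. \<Sum>b\<in>B. f a b)"
proof -
  have "{c. (case c of (a, b) \<Rightarrow> f a b) \<noteq> 0} \<subseteq> A \<times> B"
    using assms(3) by auto
  then show ?thesis
    using assms(1,2) by (simp add: Sum_any.expand_superset[of "A \<times> B"] sum.cartesian_product)
qed

definition involves_only :: "fvar set \<Rightarrow> 'a::zero fser \<Rightarrow> bool" where
  "involves_only Q f \<longleftrightarrow> (\<forall>e x. f e \<noteq> 0 \<longrightarrow> x \<notin> Q \<longrightarrow> e x = 0)"

definition part :: "fvar set \<Rightarrow> (fvar \<Rightarrow> int) \<Rightarrow> fvar \<Rightarrow> int" where
  "part Q e = (\<lambda>x. if x \<in> Q then e x else 0)"

lemma involves_onlyD: "involves_only Q f \<Longrightarrow> f e \<noteq> 0 \<Longrightarrow> x \<notin> Q \<Longrightarrow> e x = 0"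
  by (auto simp: involves_only_def)

text \<open>A monomial in the variables \<open>Q \<union> R\<close> splits in only one way into a monomial in \<open>Q\<close> and one in
  \<open>R\<close>, so a product of series in disjoint variables has one summand per coefficient.\<close>
lemma fconv_disjoint:
  assumes zero: "\<And>b. m 0 b = 0" "\<And>a. m a 0 = 0"
    and f: "involves_only Q f" and g: "involves_only R g" and disj: "Q \<inter> R = {}"
  shows "fconv m f g e = m (f (part Q e)) (g (e - part Q e))"
  unfolding fconv_def
proof (rule Sum_any_single)
  fix d assume d: "d \<noteq> part Q e"
  show "m (f d) (g (e - d)) = 0"
  proof (rule ccontr)
    assume nz0: "m (f d) (g (e - d)) \<noteq> 0"
    have nz: "f d \<noteq> 0" "g (e - d) \<noteq> 0"
      using zero nz0 by auto
    have "d x = part Q e x" for x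
      using involves_onlyD[OF f nz(1), of x] involves_onlyD[OF g nz(2), of x] disj
      by (cases "x \<in> Q"; cases "x \<in> R") (auto simp: part_def disjoint_iff)
    with d show False by (simp add: fun_eq_iff)
  qed
qed

text \<open>The same unique splitting, for the three groups of variables of an operator and its two
  arguments. Among the extended operators of the theorem only \<open>Y[u, y]\<close> itself is not of this kind,
  because it is built from two series in \<open>y\<close>.\<close>
lemma fext_disjoint:
  assumes zero: "\<And>b e. F 0 b e = 0" "\<And>a e. F a 0 e = 0"
    and F: "\<And>a b. involves_only P (F a b)" and f: "involves_only Q f" and g: "involves_only R g"
    and disj: "P \<inter> Q = {}" "P \<inter> R = {}" "Q \<inter> R = {}"
  shows "fext F f g e = F (f (part Q e)) (g (part R e)) (e - part Q e - part R e)"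
proof -
  have "(case c of (d, d') \<Rightarrow> F (f d) (g d') (e - d - d')) = 0"
    if c: "c \<noteq> (part Q e, part R e)" for c
  proof (rule ccontr)
    obtain d d' where dd: "c = (d, d')" by (cases c)
    assume "(case c of (d, d') \<Rightarrow> F (f d) (g d') (e - d - d')) \<noteq> 0"
    then have nz3: "F (f d) (g d') (e - d - d') \<noteq> 0" by (simp add: dd)
    then have nz: "f d \<noteq> 0" "g d' \<noteq> 0"
      using zero by auto
    have "d x = part Q e x \<and> d' x = part R e x" for x
      using involves_onlyD[OF f nz(1), of x] involves_onlyD[OF g nz(2), of x]
        involves_onlyD[OF F nz3, of x] disj
      by (cases "x \<in> P"; cases "x \<in> Q"; cases "x \<in> R") (auto simp: part_def disjoint_iff)
    then have "d = part Q e" "d' = part R e" by (simp_all add: fun_eq_iff)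
    with c dd show False by simp
  qed
  then show ?thesis
    unfolding fext_def by (subst Sum_any_single[of "(part Q e, part R e)"]) auto
qed

lemma involves_only_fconv:
  assumes zero: "\<And>b. m 0 b = 0" "\<And>a. m a 0 = 0"
    and f: "involves_only Q f" and g: "involves_only R g"
  shows "involves_only (Q \<union> R) (fconv m f g)"
  unfolding involves_only_def
proof (intro allI impI)
  fix e x assume nz: "fconv m f g e \<noteq> 0" and x: "x \<notin> Q \<union> R"
  obtain d where "m (f d) (g (e - d)) \<noteq> 0"
    using nz unfolding fconv_def by (rule Sum_any.not_neutral_obtains_not_neutral)
  then have nz: "f d \<noteq> 0" "g (e - d) \<noteq> 0"
    using zero by auto
  show "e x = 0"
    using involves_onlyD[OF f nz(1), of x] involves_onlyD[OF g nz(2), of x] x by simp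
qed

lemma involves_only_fext:
  assumes zero: "\<And>b e. F 0 b e = 0" "\<And>a e. F a 0 e = 0"
    and F: "\<And>a b. involves_only P (F a b)" and f: "involves_only Q f" and g: "involves_only R g"
  shows "involves_only (P \<union> Q \<union> R) (fext F f g)"
  unfolding involves_only_def
proof (intro allI impI)
  fix e x assume nz: "fext F f g e \<noteq> 0" and x: "x \<notin> P \<union> Q \<union> R"
  obtain c where "(case c of (d, d') \<Rightarrow> F (f d) (g d') (e - d - d')) \<noteq> 0"
    using nz unfolding fext_def by (rule Sum_any.not_neutral_obtains_not_neutral)
  then obtain d d' where nz3: "F (f d) (g d') (e - d - d') \<noteq> 0" by (cases c) auto
  then have nz: "f d \<noteq> 0" "g d' \<noteq> 0"
    using zero by auto
  show "e x = 0"
    using involves_onlyD[OF f nz(1), of x] involves_onlyD[OF g nz(2), of x]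
      involves_onlyD[OF F nz3, of x] x by simp
qed

lemma involves_only_fsubst:
  assumes "\<And>b. s 0 b = 0" and p: "\<And>k. involves_only P (p k)"
  shows "involves_only P (fsubst s p f)"
  unfolding involves_only_def
proof (intro allI impI)
  fix e x assume nz: "fsubst s p f e \<noteq> 0" and x: "x \<notin> P"
  obtain k where "s (p k e) (f k) \<noteq> 0"
    using nz unfolding fsubst_def by (rule Sum_any.not_neutral_obtains_not_neutral)
  then have "p k e \<noteq> 0" using assms(1) by metis
  then show "e x = 0" using involves_onlyD[OF p _ x] by simp
qed

lemma involves_only_fconst: "involves_only {} (fconst a)"
  by (auto simp: involves_only_def fconst_def)

lemma eq_expo_iff: "e = expo x k \<longleftrightarrow> e x = k \<and> (\<forall>v. v \<noteq> x \<longrightarrow> e v = 0)"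
  by (auto simp: expo_def fun_eq_iff)

lemma involves_only_of_fls: "involves_only {x} (of_fls x F)"
  by (auto simp: involves_only_def of_fls_def eq_expo_iff split: if_splits)

lemma involves_only_fmono: "involves_only {x} (fmono c x k)"
  by (auto simp: involves_only_def fmono_def eq_expo_iff split: if_splits)

lemma eq_expo2_iff:
  "x \<noteq> y \<Longrightarrow> e = expo x k + expo y l \<longleftrightarrow> e x = k \<and> e y = l \<and> (\<forall>v. v \<noteq> x \<and> v \<noteq> y \<longrightarrow> e v = 0)"
  by (auto simp: expo_def fun_eq_iff)

lemma fmult_fmono_left: "fmult (fmono 1 x k) g e = g (e - expo x k)"
  unfolding fconv_def fmono_def by (subst Sum_any_single[of "expo x k"]) auto

lemma fexp_nth:
  "fexp c w e = (if 0 \<le> e w \<and> (\<forall>v. v \<noteq> w \<longrightarrow> e v = 0) then c ^ nat (e w) / fact (nat (e w)) else 0)"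
  by (auto simp: fexp_def of_fls_def eq_expo_iff)

lemma exp_times_nth:
  assumes "w \<noteq> x"
  shows "exp_times w x k e = (if 0 \<le> e w \<and> e x = k \<and> (\<forall>v. v \<noteq> w \<and> v \<noteq> x \<longrightarrow> e v = 0)
    then of_int k ^ nat (e w) / fact (nat (e w)) else 0)"
proof -
  have "exp_times w x k e = fexp (of_int k) w (part {w} e) * fmono 1 x k (e - part {w} e)"
    unfolding exp_times_def fexp_def
    by (rule fconv_disjoint[OF _ _ involves_only_of_fls involves_only_fmono]) (use assms in auto)
  also have "\<dots> = (if 0 \<le> e w \<and> e x = k \<and> (\<forall>v. v \<noteq> w \<and> v \<noteq> x \<longrightarrow> e v = 0)
    then of_int k ^ nat (e w) / fact (nat (e w)) else 0)"
    using assms by (auto simp: fexp_nth fmono_def eq_expo_iff part_def)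
  finally show ?thesis .
qed

lemma all_fvar:
  "(\<forall>x. P x) \<longleftrightarrow> P X0 \<and> P X1 \<and> P X2 \<and> P Y1 \<and> P Y2 \<and> P W \<and> P W1 \<and> P W2"
  by (metis fvar.exhaust)

lemma expo_nth: "expo x k v = (if v = x then k else 0)"
  by (simp add: expo_def)

lemma fmono_nth:
  "fmono c x k e = (if e x = k \<and> (\<forall>v. v \<noteq> x \<longrightarrow> e v = 0) then c powi k else 0)"
  by (simp add: fmono_def eq_expo_iff)

lemma fdiff_pow_nth:
  assumes "x \<noteq> y"
  shows "fdiff_pow x y n e = (if 0 \<le> e y \<and> e x + e y = n \<and> (\<forall>v. v \<noteq> x \<and> v \<noteq> y \<longrightarrow> e v = 0)
    then (- 1) ^ nat (e y) * (of_int n gchoose nat (e y)) else 0)"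
  by (auto simp: fdiff_pow_def eq_expo2_iff[OF assms])

text \<open>The exponent of \<open>t\<close> determines the index \<open>n\<close> in \<open>t\<^sup>-\<^sup>1 \<delta>((x - y)/(c t))\<close>, so each coefficient is
  a single term.\<close>
lemma fdelta_quotient_nth:
  assumes dist: "x \<noteq> y" "x \<noteq> t" "y \<noteq> t"
  shows "fmult (fmono 1 t (- 1)) (fdelta (\<lambda>n. fmult (fdiff_pow x y n) (fmono c t (- n)))) e
    = (if 0 \<le> e y \<and> e x + e y + e t = - 1 \<and> (\<forall>v. v \<noteq> x \<and> v \<noteq> y \<and> v \<noteq> t \<longrightarrow> e v = 0)
       then (- 1) ^ nat (e y) * (of_int (- 1 - e t) gchoose nat (e y)) * c powi (e t + 1) else 0)"
proof -
  define e' where "e' = e - expo t (- 1)"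
  have inv: "involves_only {x, y} (fdiff_pow x y n)" for n
    using dist by (auto simp: involves_only_def fdiff_pow_def eq_expo2_iff split: if_splits)
  have nth: "fmult (fdiff_pow x y n) (fmono c t (- n)) e'
      = fdiff_pow x y n (part {x, y} e') * fmono c t (- n) (e' - part {x, y} e')" for n
    by (rule fconv_disjoint[OF _ _ inv involves_only_fmono]) (use dist in auto)
  have "fmult (fmono 1 t (- 1)) (fdelta (\<lambda>n. fmult (fdiff_pow x y n) (fmono c t (- n)))) e
      = Sum_any (\<lambda>n. fmult (fdiff_pow x y n) (fmono c t (- n)) e')"
    by (simp add: fmult_fmono_left e'_def fdelta_def fsubst_def)
  also have "\<dots> = fmult (fdiff_pow x y (- 1 - e t)) (fmono c t (- (- 1 - e t))) e'"
  proof (rule Sum_any_single)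
    fix n assume "n \<noteq> - 1 - e t"
    then have "fmono c t (- n) (e' - part {x, y} e') = 0"
      using dist by (auto simp: fmono_def eq_expo_iff e'_def part_def expo_nth)
    then show "fmult (fdiff_pow x y n) (fmono c t (- n)) e' = 0"
      by (simp add: nth)
  qed
  also have "\<dots> = (if 0 \<le> e y \<and> e x + e y + e t = - 1 \<and> (\<forall>v. v \<noteq> x \<and> v \<noteq> y \<and> v \<noteq> t \<longrightarrow> e v = 0)
       then (- 1) ^ nat (e y) * (of_int (- 1 - e t) gchoose nat (e y)) * c powi (e t + 1) else 0)"
  proof -
    have 1: "part {x, y} e' x = e x" "part {x, y} e' y = e y"
      "\<forall>v. v \<noteq> x \<and> v \<noteq> y \<longrightarrow> part {x, y} e' v = 0" "(e' - part {x, y} e') t = e t + 1"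
      using dist by (auto simp: e'_def part_def expo_nth)
    have 2: "(\<forall>v. v \<noteq> t \<longrightarrow> (e' - part {x, y} e') v = 0) \<longleftrightarrow>
        (\<forall>v. v \<noteq> x \<and> v \<noteq> y \<and> v \<noteq> t \<longrightarrow> e v = 0)"
      by (intro all_cong1) (auto simp: e'_def part_def expo_nth)
    show ?thesis
      unfolding nth fmono_nth fdiff_pow_nth[OF dist(1)] 2 using 1 by auto
  qed
  finally show ?thesis .
qed

lemma fconst_0: "fconst a 0 = a"
  by (simp add: fconst_def)

lemma part_empty: "part {} e = 0"
  by (simp add: part_def zero_fun_def)

lemma part_nth: "part Q e x = (if x \<in> Q then e x else 0)"
  by (simp add: part_def)

lemma part_support:
  "(\<forall>v. v \<noteq> x \<longrightarrow> (e - part {y} e) v = 0) \<longleftrightarrow> (\<forall>v. v \<noteq> x \<and> v \<noteq> y \<longrightarrow> e v = 0)"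
  by (intro all_cong1) (auto simp: part_nth)

lemma if_nonzeroD: "(if P then a else 0) \<noteq> 0 \<Longrightarrow> P"
  by (simp split: if_splits)

text \<open>The exponent of \<open>X1\<close> is the index \<open>n\<close> of the delta series.\<close>
lemma exp_delta_nth:
  "fdelta (\<lambda>n. fmult (fexp (of_int (- n)) W) (fmult (exp_times W1 X1 n) (exp_times W2 X2 (- n)))) e
    = (if 0 \<le> e W \<and> 0 \<le> e W1 \<and> 0 \<le> e W2 \<and> e X2 = - e X1 \<and> e X0 = 0 \<and> e Y1 = 0 \<and> e Y2 = 0
       then (- of_int (e X1)) ^ nat (e W) / fact (nat (e W))
          * (of_int (e X1) ^ nat (e W1) / fact (nat (e W1))
             * ((- of_int (e X1)) ^ nat (e W2) / fact (nat (e W2)))) else 0)"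
proof -
  let ?p = "\<lambda>n. fmult (fexp (of_int (- n)) W) (fmult (exp_times W1 X1 n) (exp_times W2 X2 (- n)))"
  have exp_times: "involves_only {w, x} (exp_times w x k)" if "w \<noteq> x" for w x k
    using that by (auto simp: involves_only_def exp_times_nth split: if_splits)
  have p: "?p n e = (if 0 \<le> e W \<and> 0 \<le> e W1 \<and> 0 \<le> e W2 \<and> e X1 = n \<and> e X2 = - n \<and> e X0 = 0 \<and> e Y1 = 0 \<and> e Y2 = 0
       then (- of_int n) ^ nat (e W) / fact (nat (e W))
          * (of_int n ^ nat (e W1) / fact (nat (e W1))
             * ((- of_int n) ^ nat (e W2) / fact (nat (e W2)))) else 0)" for n
  proof -
    have inner: "fmult (exp_times W1 X1 n) (exp_times W2 X2 (- n)) e'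
        = exp_times W1 X1 n (part {W1, X1} e') * exp_times W2 X2 (- n) (e' - part {W1, X1} e')" for e'
      by (rule fconv_disjoint[OF _ _ exp_times exp_times]) auto
    have "involves_only ({W1, X1} \<union> {W2, X2}) (fmult (exp_times W1 X1 n) (exp_times W2 X2 (- n)))"
      by (rule involves_only_fconv[OF _ _ exp_times exp_times]) auto
    then have "?p n e = fexp (of_int (- n)) W (part {W} e)
        * fmult (exp_times W1 X1 n) (exp_times W2 X2 (- n)) (e - part {W} e)"
      unfolding fexp_def by (intro fconv_disjoint[OF _ _ involves_only_of_fls]) auto
    then show ?thesis
      unfolding inner by (simp add: fexp_nth exp_times_nth part_nth all_fvar)
  qed
  have "fdelta ?p e = Sum_any (\<lambda>n. ?p n e)"
    by (simp add: fdelta_def fsubst_def)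
  also have "\<dots> = ?p (e X1) e"
  proof (rule Sum_any_single)
    fix n assume "n \<noteq> e X1"
    then show "?p n e = 0" unfolding p by simp
  qed
  finally show ?thesis unfolding p by simp
qed

text \<open>The coefficients of \<open>e\<^bsup>ax\<^esup> e\<^bsup>bx\<^esup> = e\<^bsup>(a+b)x\<^esup>\<close>.\<close>
lemma exp_add_coefficient:
  "(\<Sum>s\<le>i. a ^ s / fact s * (b ^ (i - s) / fact (i - s))) = (a + b) ^ i / (fact i :: complex)"
proof -
  have "fps_nth (fps_exp (a + b)) i = (\<Sum>s\<le>i. fps_nth (fps_exp a) s * fps_nth (fps_exp b) (i - s))"
    unfolding fps_exp_add_mult fps_mult_nth by (simp add: atLeast0AtMost)
  then show ?thesis by simp
qed

section \<open>The residue of exponential times power, and the square-bracket coefficients\<close>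

lemma fps_to_fls_exp_deriv: "fls_deriv (fps_to_fls (fps_exp (a::complex))) = fls_const a * fps_to_fls (fps_exp a)"
  by (simp add: fls_deriv_fps_to_fls fls_times_fps_to_fls flip: fls_const_def)

lemma subdegree_exp_minus_one: "fls_subdegree (fps_to_fls (fps_exp (1::complex)) - 1) = 1"
  by (rule fls_subdegree_eqI) (auto simp: )

text \<open>Only negative \<open>k\<close> need an argument. With \<open>E = e\<^sup>w - 1\<close>, \<open>G = E\<^sup>-\<^sup>1\<close> and
  \<open>R(c, i) = Res e\<^bsup>cw\<^esup> G\<^bsup>i+1\<^esup>\<close>, the derivative of \<open>e\<^bsup>cw\<^esup> G\<^bsup>i+1\<^esup>\<close> has residue \<open>0\<close>, which says
  \<open>(i + 1) R(c + 1, i + 1) = c R(c, i)\<close>. This is the absorption recursion of the binomial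
  coefficients, and \<open>R(c, 0) = 1\<close> because the product starts with \<open>w\<^sup>-\<^sup>1\<close>.\<close>
lemma residue_exp_minus_one:
  fixes a :: complex
  shows "fls_nth (fps_to_fls (fps_exp a) * (fps_to_fls (fps_exp 1) - 1) powi k) (- 1)
    = (if k < 0 then (a - 1) gchoose nat (- k - 1) else 0)"
proof (cases "k < 0")
  case False
  have "0 \<le> fls_subdegree (fps_to_fls (fps_exp a) :: complex fls)"
    by (simp add: fls_subdegree_fls_to_fps_gt0)
  with False show ?thesis
    by (simp add: fls_times_nth_eq0 subdegree_exp_minus_one)
next
  case True
  define T where "T c = (fps_to_fls (fps_exp c) :: complex fls)" for c
  define E where "E = T 1 - 1"
  define G where "G = inverse E"
  define R where "R c i = fls_nth (T c * G ^ Suc i) (- 1)" for c i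
  have sE: "fls_subdegree E = 1"
    by (simp add: E_def T_def subdegree_exp_minus_one)
  then have "E \<noteq> 0" by auto
  have sG: "fls_subdegree G = - 1"
    by (simp add: G_def fls_inverse_subdegree sE)
  have T_add: "T c * T d = T (c + d)" for c d
    by (simp add: T_def fls_times_fps_to_fls fps_exp_add_mult)
  have T_deriv: "fls_deriv (T c) = fls_const c * T c" for c
    by (simp add: T_def fps_to_fls_exp_deriv)
  have EG: "E * G = 1"
    using \<open>E \<noteq> 0\<close> by (simp add: G_def)
  have "fls_deriv (E * G) = 0"
    by (simp add: EG)
  then have "E * fls_deriv G = - (T 1 * G)"
    by (simp add: E_def T_deriv algebra_simps add_eq_0_iff)
  then have "E * G * fls_deriv G = - (T 1 * G * G)"
    by (metis mult.commute mult.assoc mult_minus_left)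
  then have G_deriv: "fls_deriv G = - (T 1 * G * G)"
    by (simp add: EG)
  have R_0: "R c 0 = 1" for c
  proof -
    have "fls_subdegree (T c) = 0"
      by (rule fls_subdegree_eqI) (auto simp: T_def)
    moreover have "fls_nth G (- 1) = 1"
      using fls_inverse_base2[of E] by (simp add: sE G_def) (simp add: E_def T_def)
    ultimately show ?thesis
      using fls_times_base[of "T c" G] by (simp add: R_def sG) (simp add: T_def)
  qed
  have R_Suc: "of_nat (Suc i) * R (c + 1) (Suc i) = c * R c i" for c i
  proof -
    have "fls_deriv (T c * G ^ Suc i)
        = fls_const c * (T c * G ^ Suc i) - of_nat (Suc i) * (T c * T 1 * G ^ Suc (Suc i))"
      unfolding fls_deriv_mult fls_deriv_power T_deriv G_deriv by (simp add: algebra_simps)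
    also have "fls_nth \<dots> (- 1) = c * R c i - of_nat (Suc i) * R (c + 1) (Suc i)"
      unfolding T_add by (simp add: R_def fls_of_nat del: power_Suc of_nat_Suc)
    finally show ?thesis
      using fls_deriv_residue[of "T c * G ^ Suc i"] by simp
  qed
  have R: "R c i = (c - 1) gchoose i" for c i
  proof (induction i arbitrary: c)
    case 0
    then show ?case by (simp add: R_0)
  next
    case (Suc i)
    have "of_nat (Suc i) * R c (Suc i) = of_nat (Suc i) * ((c - 1) gchoose Suc i)"
      using R_Suc[of i "c - 1"] by (simp add: Suc.IH gbinomial_absorption del: of_nat_Suc)
    then show ?case by (simp del: of_nat_Suc)
  qed
  have "E powi k = G ^ Suc (nat (- k - 1))"
  proof -
    have "nat (- k) = Suc (nat (- k - 1))" using True by simp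
    then show ?thesis using True by (simp add: power_int_def G_def power_inverse)
  qed
  then show ?thesis
    using True R[of a "nat (- k - 1)"] by (simp add: R_def E_def T_def)
qed

text \<open>The product formula with the index of the power series as summation variable; the
  bound \<open>J\<close> may be chosen uniformly for several coefficients.\<close>
lemma fps_times_fls_nth:
  fixes F :: "complex fls"
  assumes "\<And>m. m < l - int J \<Longrightarrow> fls_nth F m = 0"
  shows "fls_nth (fps_to_fls f * F) l = (\<Sum>j\<le>J. fps_nth f j * fls_nth F (l - int j))"
proof -
  let ?t = "\<lambda>i. fls_nth (fps_to_fls f) i * fls_nth F (l - i)"
  have "fls_nth (fps_to_fls f * F) l = (\<Sum>i=fls_subdegree (fps_to_fls f)..l - fls_subdegree F. ?t i)"
    by (rule fls_times_nth)
  also have "\<dots> = Sum_any ?t"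
  proof (rule Sum_any.expand_superset[symmetric])
    show "{i. ?t i \<noteq> 0} \<subseteq> {fls_subdegree (fps_to_fls f)..l - fls_subdegree F}"
    proof
      fix i assume "i \<in> {i. ?t i \<noteq> 0}"
      then have "\<not> i < fls_subdegree (fps_to_fls f)" "\<not> l - i < fls_subdegree F"
        using fls_eq0_below_subdegree[of i "fps_to_fls f"] fls_eq0_below_subdegree[of "l - i" F]
        by (auto simp del: fps_to_fls_nth)
      then show "i \<in> {fls_subdegree (fps_to_fls f)..l - fls_subdegree F}" by simp
    qed
  qed simp
  also have "\<dots> = Sum_any (\<lambda>j. ?t (int j))"
  proof (rule Sum_any_reindex)
    fix d assume "d \<notin> range int"
    then have "d < 0" by (metis nonneg_int_cases not_less rangeI)
    then show "?t d = 0" by simp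
  qed simp
  also have "\<dots> = (\<Sum>j\<le>J. ?t (int j))"
  proof (rule Sum_any.expand_superset)
    have "?t (int j) = 0" if "J < j" for j
      using that assms[of "l - int j"] by simp
    then show "{j. ?t (int j) \<noteq> 0} \<subseteq> {..J}"
      by (force simp: not_less[symmetric])
  qed simp
  finally show ?thesis by simp
qed

text \<open>The coefficient of \<open>y\<^sup>j\<close> in \<open>e\<^bsup>yL(0)\<^esup> u\<close>.\<close>
definition exp_L0_coeff :: "'v::ab_group_add vertex_data \<Rightarrow> 'v \<Rightarrow> nat \<Rightarrow> 'v" where
  "exp_L0_coeff V u j = scal V (1 / fact j) ((Lop V 0 ^^ j) u)"

text \<open>The coefficient of \<open>y\<^sup>l\<close> in \<open>Y[u, y]v\<close>, see \<open>Ybracket_nth\<close>.\<close>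
definition bracket_coeff :: "'v::ab_group_add vertex_data \<Rightarrow> 'v \<Rightarrow> 'v \<Rightarrow> int \<Rightarrow> 'v" where
  "bracket_coeff V u v l = Sum_any (\<lambda>j::nat. Sum_any (\<lambda>k.
     scal V (fls_nth ((fps_to_fls (fps_exp 1) - 1) powi k) (l - int j))
       (Ycoeff V (exp_L0_coeff V u j) v k)))"

text \<open>The vector \<open>Res\<^sub>w e\<^bsup>cw\<^esup> Y[u, w]v\<close>.\<close>
definition bracket_residue :: "'v::ab_group_add vertex_data \<Rightarrow> complex \<Rightarrow> 'v \<Rightarrow> 'v \<Rightarrow> 'v" where
  "bracket_residue V c u v = Sum_any (\<lambda>j::nat. scal V (c ^ j / fact j) (bracket_coeff V u v (- 1 - int j)))"

context vertex_operator_algebra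
begin

section \<open>Commutators of modes from the Jacobi identity\<close>

lemma mode_add_left: "mode V (u + u') n z = mode V u n z + mode V u' n z"
  using mode_linear_left[of n z] by (simp add: Vector_Spaces.linear_iff)

lemma mode_add_right: "mode V u n (z + z') = mode V u n z + mode V u n z'"
  using mode_linear_right[of u n] by (simp add: Vector_Spaces.linear_iff)

lemma mode_scale_left: "mode V (scal V c u) n z = scal V c (mode V u n z)"
  using mode_linear_left[of n z] by (simp add: Vector_Spaces.linear_iff)

lemma mode_scale_right: "mode V u n (scal V c z) = scal V c (mode V u n z)"
  using mode_linear_right[of u n] by (simp add: Vector_Spaces.linear_iff)

lemma mode_zero_left [simp]: "mode V 0 n z = 0"
  using mode_scale_left[of 0 0 n z] by simp

lemma mode_zero_right [simp]: "mode V u n 0 = 0"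
  using mode_scale_right[of u n 0 0] by simp

lemma Ycoeff_zero [simp]: "Ycoeff V 0 z k = 0" "Ycoeff V u 0 k = 0"
  by (simp_all add: Ycoeff_def)

lemma Ycoeff_truncation: "\<exists>N. \<forall>k<N. Ycoeff V u z k = 0"
proof -
  obtain N where "\<forall>n\<ge>N. mode V u n z = 0" using truncation by blast
  then have "\<forall>k< - N. Ycoeff V u z k = 0" by (simp add: Ycoeff_def)
  then show ?thesis by blast
qed

lemma Yop_zero: "Yop V p 0 z e = 0" "Yop V p u 0 e = 0"
  by (simp_all add: Yop_def fsubst_def)

lemma Yop_fmono:
  "Yop V (fmono 1 x) u z e = (if \<forall>v. v \<noteq> x \<longrightarrow> e v = 0 then Ycoeff V u z (e x) else 0)"
proof -
  have "Yop V (fmono 1 x) u z e = scal V (fmono 1 x (e x) e) (Ycoeff V u z (e x))"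
    unfolding Yop_def fsubst_def
    by (rule Sum_any_single) (auto simp: fmono_def eq_expo_iff)
  then show ?thesis by (auto simp: fmono_nth)
qed

lemma involves_only_Yop: "(\<And>k. involves_only P (p k)) \<Longrightarrow> involves_only P (Yop V p u z)"
  unfolding Yop_def by (rule involves_only_fsubst) auto

lemma involves_only_Yop_fmono: "involves_only {x} (Yop V (fmono c x) u z)"
  by (rule involves_only_Yop) (rule involves_only_fmono)

lemma fext_Y_single:
  "fext (Yop V (fmono 1 y)) (fconst v) (fconst z) e
    = (if \<forall>w. w \<noteq> y \<longrightarrow> e w = 0 then Ycoeff V v z (e y) else 0)"
proof -
  have "fext (Yop V (fmono 1 y)) (fconst v) (fconst z) e
    = Yop V (fmono 1 y) (fconst v (part {} e)) (fconst z (part {} e)) (e - part {} e - part {} e)"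
    by (rule fext_disjoint[where F = "Yop V (fmono 1 y)", OF Yop_zero involves_only_Yop_fmono
          involves_only_fconst involves_only_fconst]) auto
  also have "\<dots> = (if \<forall>w. w \<noteq> y \<longrightarrow> e w = 0 then Ycoeff V v z (e y) else 0)"
    unfolding Yop_fmono part_empty fconst_0 diff_0_right ..
  finally show ?thesis .
qed

lemma involves_only_Y_single:
  "involves_only {y} (fext (Yop V (fmono 1 y)) (fconst v) (fconst z))"
  using involves_only_fext[where F = "Yop V (fmono 1 y)", OF Yop_zero involves_only_Yop_fmono
          involves_only_fconst involves_only_fconst] by simp

lemma fext_Y_product:
  assumes "x \<noteq> y"
  shows "fext (Yop V (fmono 1 x)) (fconst u) (fext (Yop V (fmono 1 y)) (fconst v) (fconst z)) e
    = (if \<forall>w. w \<noteq> x \<and> w \<noteq> y \<longrightarrow> e w = 0 then Ycoeff V u (Ycoeff V v z (e y)) (e x) else 0)"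
proof -
  have "fext (Yop V (fmono 1 x)) (fconst u) (fext (Yop V (fmono 1 y)) (fconst v) (fconst z)) e
    = Yop V (fmono 1 x) (fconst u (part {} e))
        (fext (Yop V (fmono 1 y)) (fconst v) (fconst z) (part {y} e)) (e - part {} e - part {y} e)"
    by (rule fext_disjoint[where F = "Yop V (fmono 1 x)", OF Yop_zero involves_only_Yop_fmono
          involves_only_fconst involves_only_Y_single]) (use assms in auto)
  also have "\<dots> = (if \<forall>w. w \<noteq> x \<and> w \<noteq> y \<longrightarrow> e w = 0
      then Ycoeff V u (Ycoeff V v z (e y)) (e x) else 0)"
    unfolding Yop_fmono fext_Y_single part_empty fconst_0 diff_0_right part_support
    by (intro if_cong refl) (use assms in \<open>simp add: part_nth\<close>)
  finally show ?thesis .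
qed

lemma fext_Y_iterate:
  assumes "x \<noteq> y"
  shows "fext (Yop V (fmono 1 y)) (fext (Yop V (fmono 1 x)) (fconst u) (fconst v)) (fconst z) e
    = (if \<forall>w. w \<noteq> y \<and> w \<noteq> x \<longrightarrow> e w = 0 then Ycoeff V (Ycoeff V u v (e x)) z (e y) else 0)"
proof -
  have "fext (Yop V (fmono 1 y)) (fext (Yop V (fmono 1 x)) (fconst u) (fconst v)) (fconst z) e
    = Yop V (fmono 1 y) (fext (Yop V (fmono 1 x)) (fconst u) (fconst v) (part {x} e))
        (fconst z (part {} e)) (e - part {x} e - part {} e)"
    by (rule fext_disjoint[where F = "Yop V (fmono 1 y)", OF Yop_zero involves_only_Yop_fmono
          involves_only_Y_single involves_only_fconst]) (use assms in auto)
  also have "\<dots> = (if \<forall>w. w \<noteq> y \<and> w \<noteq> x \<longrightarrow> e w = 0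
      then Ycoeff V (Ycoeff V u v (e x)) z (e y) else 0)"
    unfolding Yop_fmono fext_Y_single part_empty fconst_0 diff_0_right part_support
    by (intro if_cong refl) (use assms in \<open>simp add: part_nth\<close>)
  finally show ?thesis .
qed

text \<open>Taking the residue in \<open>x\<^sub>0\<close> selects the term \<open>n = 0\<close> of the delta series, and the power
  \<open>(x - y)\<^sup>0\<close> is \<open>1\<close>. Both products on the left of the Jacobi identity are instances, with
  \<open>c = 1\<close> and \<open>c = -1\<close>.\<close>
lemma residue_delta_product:
  assumes dist: "x \<noteq> y" "x \<noteq> X0" "y \<noteq> X0" and e: "e X0 = - 1" "\<forall>v. v \<noteq> x \<and> v \<noteq> y \<and> v \<noteq> X0 \<longrightarrow> e v = 0"
  shows "fconv (scal V)
      (fmult (fmono 1 X0 (- 1)) (fdelta (\<lambda>n. fmult (fdiff_pow x y n) (fmono c X0 (- n)))))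
      (fext (Yop V (fmono 1 x)) (fconst u) (fext (Yop V (fmono 1 y)) (fconst v) (fconst z))) e
    = Ycoeff V u (Ycoeff V v z (e y)) (e x)"
proof -
  let ?D = "fmult (fmono 1 X0 (- 1)) (fdelta (\<lambda>n. fmult (fdiff_pow x y n) (fmono c X0 (- n))))"
  let ?G = "fext (Yop V (fmono 1 x)) (fconst u) (fext (Yop V (fmono 1 y)) (fconst v) (fconst z))"
  have "fconv (scal V) ?D ?G e = scal V (?D (expo X0 (- 1))) (?G (e - expo X0 (- 1)))"
    unfolding fconv_def[of "scal V"]
  proof (rule Sum_any_single, rule ccontr)
    fix d assume d: "d \<noteq> expo X0 (- 1)" and nz: "scal V (?D d) (?G (e - d)) \<noteq> 0"
    have D: "?D d \<noteq> 0" and G: "?G (e - d) \<noteq> 0" using nz by auto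
    have d0: "d X0 = - 1"
      using G e(1) dist by (auto simp: fext_Y_product[OF dist(1)] split: if_splits)
    have "0 \<le> d y" "d x + d y = 0" "\<forall>v. v \<noteq> x \<and> v \<noteq> y \<and> v \<noteq> X0 \<longrightarrow> d v = 0"
      "(0::complex) gchoose nat (d y) \<noteq> 0"
      using D d0 by (auto simp: fdelta_quotient_nth[OF dist] split: if_splits)
    then have "d y = 0" "d x = 0"
      by (cases "nat (d y)"; simp)+
    with d0 d \<open>\<forall>v. v \<noteq> x \<and> v \<noteq> y \<and> v \<noteq> X0 \<longrightarrow> d v = 0\<close> show False
      by (auto simp: eq_expo_iff)
  qed
  then show ?thesis
    using dist e by (auto simp: fdelta_quotient_nth[OF dist] fext_Y_product[OF dist(1)] expo_nth)
qed

text \<open>On the right of the Jacobi identity the residue in \<open>x\<^sub>0\<close> pairs \<open>x\<^sub>0\<^sup>i\<close> from the delta series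
  with the mode \<open>u\<^sub>i v\<close>; the fixed exponent of \<open>x\<^sub>1\<close> forces the remaining index of the delta series.
  The signed coefficient of \<open>(x\<^sub>1 - x\<^sub>0)\<^bsup>k+i\<^esup>\<close>, with \<open>k\<close> the exponent of \<open>x\<^sub>1\<close>, becomes
  \<open>-k-1 gchoose i\<close> by negating the upper index.\<close>
lemma residue_delta_iterate:
  assumes e: "e X0 = - 1" "\<forall>v. v \<noteq> X0 \<and> v \<noteq> X1 \<and> v \<noteq> X2 \<longrightarrow> e v = 0"
  shows "fconv (scal V)
      (fmult (fmono 1 X2 (- 1)) (fdelta (\<lambda>n. fmult (fdiff_pow X1 X0 n) (fmono 1 X2 (- n)))))
      (fext (Yop V (fmono 1 X2)) (fext (Yop V (fmono 1 X0)) (fconst u) (fconst v)) (fconst z)) e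
    = Sum_any (\<lambda>i::nat. scal V (of_int (- e X1 - 1) gchoose i)
        (Ycoeff V (mode V u (int i) v) z (e X1 + e X2 + 1 + int i)))"
proof -
  let ?D = "fmult (fmono 1 X2 (- 1)) (fdelta (\<lambda>n. fmult (fdiff_pow X1 X0 n) (fmono 1 X2 (- n))))"
  let ?G = "fext (Yop V (fmono 1 X2)) (fext (Yop V (fmono 1 X0)) (fconst u) (fconst v)) (fconst z)"
  \<comment> \<open>The monomials of the delta series that divide the monomial \<open>e\<close> into allowed factors.\<close>
  define \<phi> where "\<phi> i = (\<lambda>_. 0)(X0 := int i, X1 := e X1, X2 := - 1 - e X1 - int i)" for i
  have dist: "X1 \<noteq> X0" "X1 \<noteq> X2" "X0 \<noteq> X2" by auto
  have "fconv (scal V) ?D ?G e = Sum_any (\<lambda>i. scal V (?D (\<phi> i)) (?G (e - \<phi> i)))"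
    unfolding fconv_def[of "scal V"]
  proof (rule Sum_any_reindex[where \<phi> = \<phi>])
    show "inj \<phi>" by (auto simp: inj_def \<phi>_def fun_eq_iff all_fvar)
  next
    fix d assume d: "d \<notin> range \<phi>"
    show "scal V (?D d) (?G (e - d)) = 0"
    proof (rule ccontr)
      assume nz: "scal V (?D d) (?G (e - d)) \<noteq> 0"
      have D: "?D d \<noteq> 0" and G: "?G (e - d) \<noteq> 0" using nz by auto
      have "d = \<phi> (nat (d X0))"
        using D G e by (auto simp: fdelta_quotient_nth[OF dist] fext_Y_iterate[OF dist(3)]
            \<phi>_def fun_eq_iff all_fvar split: if_splits)
      with d show False by blast
    qed
  qed
  also have "\<dots> = Sum_any (\<lambda>i::nat. scal V (of_int (- e X1 - 1) gchoose i)
        (Ycoeff V (mode V u (int i) v) z (e X1 + e X2 + 1 + int i)))"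
  proof (rule Sum_any.cong)
    fix i
    have "?D (\<phi> i) = (- 1) ^ i * (of_int (e X1 + int i) gchoose i)"
      unfolding fdelta_quotient_nth[OF dist] by (simp add: \<phi>_def all_fvar algebra_simps)
    also have "\<dots> = (of_int (- e X1 - 1) gchoose i)"
      by (subst gbinomial_negated_upper[of "of_int (- e X1 - 1)"]) (simp add: algebra_simps)
    finally have "?D (\<phi> i) = (of_int (- e X1 - 1) gchoose i)" .
    moreover have "?G (e - \<phi> i) = Ycoeff V (mode V u (int i) v) z (e X1 + e X2 + 1 + int i)"
      using e unfolding fext_Y_iterate[OF dist(3)]
      by (simp add: \<phi>_def all_fvar Ycoeff_def algebra_simps)
    ultimately show "scal V (?D (\<phi> i)) (?G (e - \<phi> i)) = scal V (of_int (- e X1 - 1) gchoose i)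
        (Ycoeff V (mode V u (int i) v) z (e X1 + e X2 + 1 + int i))" by simp
  qed
  finally show ?thesis .
qed

text \<open>Borcherds' commutator formula: the coefficient of \<open>x\<^sub>0\<^sup>-\<^sup>1 x\<^sub>1\<^bsup>-m-1\<^esup> x\<^sub>2\<^bsup>-n-1\<^esup>\<close> in the Jacobi
  identity.\<close>
lemma mode_commutator:
  "mode V u m (mode V v n z) - mode V v n (mode V u m z)
    = Sum_any (\<lambda>i::nat. scal V (of_int m gchoose i) (mode V (mode V u (int i) v) (m + n - int i) z))"
proof -
  define e where "e = (\<lambda>_::fvar. 0::int)(X0 := - 1, X1 := - m - 1, X2 := - n - 1)"
  have e: "e X0 = - 1" "\<forall>v. v \<noteq> X0 \<and> v \<noteq> X1 \<and> v \<noteq> X2 \<longrightarrow> e v = 0"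
    by (auto simp: e_def)
  have e12: "\<forall>v. v \<noteq> X1 \<and> v \<noteq> X2 \<and> v \<noteq> X0 \<longrightarrow> e v = 0"
    "\<forall>v. v \<noteq> X2 \<and> v \<noteq> X1 \<and> v \<noteq> X0 \<longrightarrow> e v = 0"
    by (auto simp: e_def)
  have "Ycoeff V u (Ycoeff V v z (e X2)) (e X1) - Ycoeff V v (Ycoeff V u z (e X1)) (e X2)
      = Sum_any (\<lambda>i::nat. scal V (of_int (- e X1 - 1) gchoose i)
        (Ycoeff V (mode V u (int i) v) z (e X1 + e X2 + 1 + int i)))"
    using fun_cong[OF jacobi[of u v z], of e]
    by (simp only: fun_diff_def residue_delta_iterate[OF e]
        residue_delta_product[of X1 X2, OF _ _ _ e(1) e12(1), simplified]
        residue_delta_product[of X2 X1, OF _ _ _ e(1) e12(2), simplified])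
  then show ?thesis
    by (simp add: e_def Ycoeff_def algebra_simps)
qed

section \<open>The grading and the operators X\<close>

lemma is_decomp_unique: "is_decomp V v f \<Longrightarrow> is_decomp V v g \<Longrightarrow> f = g"
  using direct_sum[of v] by blast

lemma is_decomp_hcomp: "is_decomp V v (hcomp V v)"
  unfolding hcomp_def using direct_sum[of v] by (rule theI')

lemma hcomp_eqI: "is_decomp V v f \<Longrightarrow> hcomp V v = f"
  using is_decomp_unique is_decomp_hcomp by blast

lemma hcomp_in_grade: "hcomp V v n \<in> grade V n"
  using is_decomp_hcomp[of v] by (simp add: is_decomp_def)

lemma finite_hcomp: "finite {n. hcomp V v n \<noteq> 0}"
  using is_decomp_hcomp[of v] by (simp add: is_decomp_def)

lemma Sum_any_hcomp: "Sum_any (hcomp V v) = v"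
  using is_decomp_hcomp[of v] by (simp add: is_decomp_def)

lemma hcomp_homogeneous:
  assumes "v \<in> grade V n"
  shows "hcomp V v = (\<lambda>k. if k = n then v else 0)"
proof (rule hcomp_eqI)
  have "Sum_any (\<lambda>k. if k = n then v else 0) = v"
    using Sum_any_single[of n "\<lambda>k. if k = n then v else 0"] by simp
  moreover have "{k. (if k = n then v else 0) \<noteq> 0} \<subseteq> {n}" by auto
  ultimately show "is_decomp V v (\<lambda>k. if k = n then v else 0)"
    using assms subspace_0[OF grade_subspace] finite_subset[of "{k. (if k = n then v else 0) \<noteq> 0}" "{n}"]
    by (auto simp: is_decomp_def)
qed

lemma hcomp_add: "hcomp V (u + v) = (\<lambda>n. hcomp V u n + hcomp V v n)"
proof (rule hcomp_eqI)
  have "{n. hcomp V u n + hcomp V v n \<noteq> 0} \<subseteq> {n. hcomp V u n \<noteq> 0} \<union> {n. hcomp V v n \<noteq> 0}"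
    by auto
  then have "finite {n. hcomp V u n + hcomp V v n \<noteq> 0}"
    using finite_hcomp by (meson finite_UnI finite_subset)
  then show "is_decomp V (u + v) (\<lambda>n. hcomp V u n + hcomp V v n)"
    by (simp add: is_decomp_def subspace_add[OF grade_subspace] hcomp_in_grade
        Sum_any.distrib finite_hcomp Sum_any_hcomp)
qed

lemma hcomp_scale: "hcomp V (scal V c u) = (\<lambda>n. scal V c (hcomp V u n))"
proof (rule hcomp_eqI)
  let ?S = "{n. hcomp V u n \<noteq> 0}"
  have sub: "{n. scal V c (hcomp V u n) \<noteq> 0} \<subseteq> ?S" by auto
  have "Sum_any (\<lambda>n. scal V c (hcomp V u n)) = (\<Sum>n\<in>?S. scal V c (hcomp V u n))"
    by (rule Sum_any.expand_superset[OF finite_hcomp sub])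
  also have "\<dots> = scal V c (Sum_any (hcomp V u))"
    by (simp add: scale_sum_right Sum_any.expand_set)
  finally show "is_decomp V (scal V c u) (\<lambda>n. scal V c (hcomp V u n))"
    using finite_subset[OF sub finite_hcomp]
    by (simp add: is_decomp_def subspace_scale[OF grade_subspace] hcomp_in_grade Sum_any_hcomp)
qed

lemma graded_induct [case_names homogeneous add]:
  assumes hom: "\<And>n u. u \<in> grade V n \<Longrightarrow> P u"
    and add: "\<And>u v. P u \<Longrightarrow> P v \<Longrightarrow> P (u + v)"
  shows "P u"
proof -
  have "P (sum (hcomp V u) S)" if "finite S" for S
    using that
  proof (induction S)
    case empty
    then show ?case using hom[of 0 0] subspace_0[OF grade_subspace] by simp
  next
    case (insert n S)
    then show ?case using add hom[OF hcomp_in_grade] by simp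
  qed
  from this[OF finite_hcomp[of u]] show ?thesis
    using Sum_any_hcomp[of u] by (simp add: Sum_any.expand_set)
qed

text \<open>\<open>L(0)\<close> acts on the component of degree \<open>k\<close> by \<open>k\<close>. Comparing components, an eigenvector for
  \<open>n\<close> has no component of degree \<open>k \<noteq> n\<close>.\<close>
lemma eigenvector_in_grade:
  assumes "Lop V 0 v = scal V (of_int n) v"
  shows "v \<in> grade V n"
proof -
  let ?h = "hcomp V v"
  have lin: "Lop V 0 (sum ?h S) = (\<Sum>k\<in>S. scal V (of_int k) (?h k))" if "finite S" for S
    using that
  proof (induction S)
    case empty
    show ?case by (simp add: Lop_def)
  next
    case (insert k S)
    then show ?case
      using L0_grade[OF hcomp_in_grade[of v k]] by (simp add: Lop_def mode_add_right)
  qed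
  have sub: "{k. scal V (of_int k) (?h k) \<noteq> 0} \<subseteq> {k. ?h k \<noteq> 0}" by auto
  have "Lop V 0 v = Sum_any (\<lambda>k. scal V (of_int k) (?h k))"
    using lin[OF finite_hcomp[of v]] Sum_any_hcomp[of v] Sum_any.expand_superset[OF finite_hcomp sub]
    by (simp add: Sum_any.expand_set)
  then have "is_decomp V (Lop V 0 v) (\<lambda>k. scal V (of_int k) (?h k))"
    using finite_subset[OF sub finite_hcomp] subspace_scale[OF grade_subspace hcomp_in_grade]
    by (simp add: is_decomp_def)
  then have "(\<lambda>k. scal V (of_int k) (?h k)) = (\<lambda>k. scal V (of_int n) (?h k))"
    using hcomp_eqI[of "Lop V 0 v"] hcomp_scale[of "of_int n" v] assms by simp
  then have "?h k = 0" if "k \<noteq> n" for k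
    using that fun_cong[of _ _ k] by (metis of_int_eq_iff scale_cancel_right)
  then have "Sum_any ?h = ?h n"
    by (rule Sum_any_single)
  then show ?thesis
    using Sum_any_hcomp hcomp_in_grade by metis
qed

text \<open>The commutator formula for \<open>\<omega>\<^sub>1 = L(0)\<close> and \<open>u\<^sub>n\<close> has the two terms \<open>(L(-1)u)\<^bsub>n+1\<^esub>\<close> and
  \<open>(L(0)u)\<^sub>n\<close>, and the derivative property turns the first into \<open>-(n+1) u\<^sub>n\<close>. So \<open>u\<^sub>n v\<close> is an
  eigenvector of \<open>L(0)\<close>.\<close>
lemma mode_in_grade:
  assumes u: "u \<in> grade V p" and v: "v \<in> grade V q"
  shows "mode V u n v \<in> grade V (p + q - n - 1)"
proof (rule eigenvector_in_grade)
  have "Lop V 0 (mode V u n v) - mode V u n (Lop V 0 v)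
      = Sum_any (\<lambda>i::nat. scal V (1 gchoose i) (mode V (mode V (conf V) (int i) u) (1 + n - int i) v))"
    using mode_commutator[of "conf V" 1 u n v] by (simp add: Lop_def)
  also have "\<dots> = (\<Sum>i\<in>{0, 1::nat}. scal V (1 gchoose i) (mode V (mode V (conf V) (int i) u) (1 + n - int i) v))"
  proof (rule Sum_any.expand_superset)
    have "(1::complex) gchoose i = 0" if "i \<notin> {0, 1}" for i :: nat
    proof -
      have "1 < i" using that by auto
      then show ?thesis
        using binomial_gbinomial[of 1 i, where 'a = complex] by (simp add: binomial_eq_0)
    qed
    then show "{i. scal V (1 gchoose i) (mode V (mode V (conf V) (int i) u) (1 + n - int i) v) \<noteq> 0} \<subseteq> {0, 1}"
      by auto
  qed simp
  also have "\<dots> = mode V (Lop V (- 1) u) (n + 1) v + mode V (Lop V 0 u) n v"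
    by (simp add: Lop_def add.commute)
  also have "mode V (Lop V (- 1) u) (n + 1) v = scal V (of_int (- n - 1)) (mode V u n v)"
    using derivative[of "- n - 2" u v] by (simp add: Ycoeff_def add.commute minus_diff_commute[of 1 "of_int n :: complex"])
  finally show "Lop V 0 (mode V u n v) = scal V (of_int (p + q - n - 1)) (mode V u n v)"
    by (simp add: L0_grade[OF u] L0_grade[OF v] mode_scale_left mode_scale_right
        scale_left_distrib scale_left_diff_distrib algebra_simps)
qed

lemma finite_Xcoeff: "finite {n. Ycoeff V (hcomp V u n) z (k - n) \<noteq> 0}"
  by (rule finite_subset[OF _ finite_hcomp[of u]]) auto

lemma Xcoeff_add_left: "Xcoeff V (u + u') z k = Xcoeff V u z k + Xcoeff V u' z k"
  unfolding Xcoeff_def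
  by (subst Sum_any.distrib[symmetric], rule finite_Xcoeff, rule finite_Xcoeff)
    (simp add: hcomp_add Ycoeff_def mode_add_left)

lemma Xcoeff_add_right: "Xcoeff V u (z + z') k = Xcoeff V u z k + Xcoeff V u z' k"
  unfolding Xcoeff_def
  by (subst Sum_any.distrib[symmetric], rule finite_Xcoeff, rule finite_Xcoeff)
    (simp add: Ycoeff_def mode_add_right)

lemma Xcoeff_homogeneous:
  assumes "u \<in> grade V p"
  shows "Xcoeff V u z k = mode V u (p - 1 - k) z"
proof -
  have "Xcoeff V u z k = Ycoeff V (hcomp V u p) z (k - p)"
    unfolding Xcoeff_def
    by (rule Sum_any_single) (simp add: hcomp_homogeneous[OF assms])
  then show ?thesis
    by (simp add: hcomp_homogeneous[OF assms] Ycoeff_def algebra_simps)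
qed

lemma Xcoeff_zero [simp]: "Xcoeff V 0 z k = 0" "Xcoeff V u 0 k = 0"
  using Xcoeff_homogeneous[of 0 0 z k] subspace_0[OF grade_subspace, of 0] by (auto simp: Xcoeff_def)

lemma Xcoeff_scale_left: "Xcoeff V (scal V c u) z k = scal V c (Xcoeff V u z k)"
proof (induction u rule: graded_induct)
  case (homogeneous n u)
  then show ?case
    using subspace_scale[OF grade_subspace homogeneous, of c]
    by (simp add: Xcoeff_homogeneous mode_scale_left)
next
  case (add u v)
  then show ?case by (simp add: scale_right_distrib Xcoeff_add_left)
qed

lemma Xcoeff_sum_left: "Xcoeff V (sum f A) z k = (\<Sum>a\<in>A. Xcoeff V (f a) z k)"
  by (induction A rule: infinite_finite_induct) (auto simp: Xcoeff_add_left)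

section \<open>The coefficientwise commutator identity\<close>

lemma L0_power_add: "(Lop V 0 ^^ j) (u + u') = (Lop V 0 ^^ j) u + (Lop V 0 ^^ j) u'"
  by (induction j) (simp_all add: Lop_def mode_add_right)

lemma L0_power_homogeneous:
  assumes "u \<in> grade V p"
  shows "(Lop V 0 ^^ j) u = scal V (of_int p ^ j) u"
proof (induction j)
  case (Suc j)
  have "Lop V 0 (scal V (of_int p ^ j) u) = scal V (of_int p ^ j) (Lop V 0 u)"
    by (simp add: Lop_def mode_scale_right)
  then show ?case
    using Suc by (simp add: L0_grade[OF assms] mult.commute)
qed simp

lemma exp_L0_coeff_add: "exp_L0_coeff V (u + u') j = exp_L0_coeff V u j + exp_L0_coeff V u' j"
  by (simp add: exp_L0_coeff_def L0_power_add scale_right_distrib)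

lemma exp_L0_coeff_homogeneous:
  "u \<in> grade V p \<Longrightarrow> exp_L0_coeff V u j = scal V (of_int p ^ j / fact j) u"
  by (simp add: exp_L0_coeff_def L0_power_homogeneous)

lemma exp_L0_coeff_zero [simp]: "exp_L0_coeff V 0 j = 0"
  using exp_L0_coeff_homogeneous[of 0 0 j] subspace_0[OF grade_subspace] by simp

lemma Ycoeff_add_left: "Ycoeff V (u + u') z k = Ycoeff V u z k + Ycoeff V u' z k"
  by (simp add: Ycoeff_def mode_add_left)

lemma Ycoeff_scale_left: "Ycoeff V (scal V c u) z k = scal V c (Ycoeff V u z k)"
  by (simp add: Ycoeff_def mode_scale_left)

text \<open>For homogeneous \<open>u\<close> all \<open>L(0)\<^sup>j u\<close> are multiples of \<open>u\<close>, so one truncation bound serves every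
  \<open>j\<close>; a sum of finitely many homogeneous vectors takes the least of their bounds.\<close>
lemma exp_L0_truncation: "\<exists>N. \<forall>k<N. \<forall>j. Ycoeff V (exp_L0_coeff V u j) v k = 0"
proof (induction u rule: graded_induct)
  case (homogeneous p u)
  obtain N where "\<forall>k<N. Ycoeff V u v k = 0" using Ycoeff_truncation by blast
  then show ?case
    using homogeneous by (intro exI[of _ N]) (simp add: exp_L0_coeff_homogeneous Ycoeff_scale_left)
next
  case (add u u')
  then obtain N N' where "\<forall>k<N. \<forall>j. Ycoeff V (exp_L0_coeff V u j) v k = 0"
    "\<forall>k<N'. \<forall>j. Ycoeff V (exp_L0_coeff V u' j) v k = 0" by blast
  then show ?case
    by (intro exI[of _ "min N N'"]) (simp add: exp_L0_coeff_add Ycoeff_add_left)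
qed

lemma exp_minus_one_power_nth_eq_0:
  "l < k \<Longrightarrow> fls_nth ((fps_to_fls (fps_exp (1::complex)) - 1) powi k) l = 0"
  by (rule fls_eq0_below_subdegree) (simp add: subdegree_exp_minus_one)

text \<open>The power \<open>(e\<^sup>y - 1)\<^sup>k\<close> starts at \<open>y\<^sup>k\<close>, so only \<open>N \<le> k \<le> l - j\<close> contribute. The ranges are
  left adjustable so that several coefficients can share them.\<close>
lemma bracket_coeff_eq_sum:
  assumes N: "\<forall>k<N. \<forall>j. Ycoeff V (exp_L0_coeff V u j) v k = 0" and J: "l - N \<le> int J" and M: "l \<le> M"
  shows "bracket_coeff V u v l = (\<Sum>j\<le>J. \<Sum>k\<in>{N..M}.
     scal V (fls_nth ((fps_to_fls (fps_exp 1) - 1) powi k) (l - int j))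
       (Ycoeff V (exp_L0_coeff V u j) v k))"
proof -
  let ?t = "\<lambda>j k. scal V (fls_nth ((fps_to_fls (fps_exp 1) - 1) powi k) (l - int j))
       (Ycoeff V (exp_L0_coeff V u j) v k)"
  have t: "N \<le> k \<and> k \<le> l - int j" if "?t j k \<noteq> 0" for j k
    using that N exp_minus_one_power_nth_eq_0[of "l - int j" k] by (cases "k < N"; cases "l - int j < k") auto
  have inner: "Sum_any (?t j) = (\<Sum>k\<in>{N..M}. ?t j k)" for j
  proof (rule Sum_any.expand_superset)
    show "{k. ?t j k \<noteq> 0} \<subseteq> {N..M}"
    proof
      fix k assume "k \<in> {k. ?t j k \<noteq> 0}"
      then show "k \<in> {N..M}" using t[of k j] M by simp
    qed
  qed simp
  have "Sum_any (\<lambda>j. Sum_any (?t j)) = (\<Sum>j\<le>J. Sum_any (?t j))"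
  proof (rule Sum_any.expand_superset)
    show "{j. Sum_any (?t j) \<noteq> 0} \<subseteq> {..J}"
    proof
      fix j assume "j \<in> {j. Sum_any (?t j) \<noteq> 0}"
      then obtain k where "?t j k \<noteq> 0"
        using Sum_any.not_neutral_obtains_not_neutral by blast
      then show "j \<in> {..J}" using t[of k j] J by simp
    qed
  qed simp
  then show ?thesis
    by (simp add: bracket_coeff_def inner)
qed

lemma bracket_coeff_truncation:
  assumes N: "\<forall>k<N. \<forall>j. Ycoeff V (exp_L0_coeff V u j) v k = 0" and "l < N"
  shows "bracket_coeff V u v l = 0"
  using bracket_coeff_eq_sum[OF N, of l 0 l] assms(2) by simp

lemma bracket_coeff_zero [simp]: "bracket_coeff V 0 v l = 0" "bracket_coeff V u 0 l = 0"
  by (simp_all add: bracket_coeff_def)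

lemma bracket_coeff_add_left: "bracket_coeff V (u + u') v l = bracket_coeff V u v l + bracket_coeff V u' v l"
proof -
  obtain N1 N2 where N1: "\<forall>k<N1. \<forall>j. Ycoeff V (exp_L0_coeff V u j) v k = 0"
    and N2: "\<forall>k<N2. \<forall>j. Ycoeff V (exp_L0_coeff V u' j) v k = 0"
    using exp_L0_truncation by metis
  define N where "N = min N1 N2"
  have N: "\<forall>k<N. \<forall>j. Ycoeff V (exp_L0_coeff V u j) v k = 0"
    "\<forall>k<N. \<forall>j. Ycoeff V (exp_L0_coeff V u' j) v k = 0"
    "\<forall>k<N. \<forall>j. Ycoeff V (exp_L0_coeff V (u + u') j) v k = 0"
    using N1 N2 by (simp_all add: N_def exp_L0_coeff_add Ycoeff_add_left)
  have J: "l - N \<le> int (nat (l - N))" by simp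
  show ?thesis
    unfolding bracket_coeff_eq_sum[OF N(1) J order_refl] bracket_coeff_eq_sum[OF N(2) J order_refl]
      bracket_coeff_eq_sum[OF N(3) J order_refl]
    by (simp add: exp_L0_coeff_add Ycoeff_add_left scale_right_distrib sum.distrib)
qed

lemma bracket_residue_eq_sum:
  assumes N: "\<forall>k<N. \<forall>j. Ycoeff V (exp_L0_coeff V u j) v k = 0" and J: "- 1 - N \<le> int J"
  shows "bracket_residue V c u v = (\<Sum>j\<le>J. scal V (c ^ j / fact j) (bracket_coeff V u v (- 1 - int j)))"
  unfolding bracket_residue_def
proof (rule Sum_any.expand_superset)
  have "bracket_coeff V u v (- 1 - int j) = 0" if "J < j" for j
    by (rule bracket_coeff_truncation[OF N]) (use that J in linarith)
  then show "{j. scal V (c ^ j / fact j) (bracket_coeff V u v (- 1 - int j)) \<noteq> 0} \<subseteq> {..J}"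
    by (force simp: not_less[symmetric])
qed simp

lemma bracket_residue_add_left:
  "bracket_residue V c (u + u') v = bracket_residue V c u v + bracket_residue V c u' v"
proof -
  obtain N1 N2 where N1: "\<forall>k<N1. \<forall>j. Ycoeff V (exp_L0_coeff V u j) v k = 0"
    and N2: "\<forall>k<N2. \<forall>j. Ycoeff V (exp_L0_coeff V u' j) v k = 0"
    using exp_L0_truncation by metis
  define N where "N = min N1 N2"
  have N: "\<forall>k<N. \<forall>j. Ycoeff V (exp_L0_coeff V u j) v k = 0"
    "\<forall>k<N. \<forall>j. Ycoeff V (exp_L0_coeff V u' j) v k = 0"
    "\<forall>k<N. \<forall>j. Ycoeff V (exp_L0_coeff V (u + u') j) v k = 0"
    using N1 N2 by (simp_all add: N_def exp_L0_coeff_add Ycoeff_add_left)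
  have J: "- 1 - N \<le> int (nat (- 1 - N))" by simp
  show ?thesis
    unfolding bracket_residue_eq_sum[OF N(1) J] bracket_residue_eq_sum[OF N(2) J]
      bracket_residue_eq_sum[OF N(3) J]
    by (simp add: bracket_coeff_add_left scale_right_distrib sum.distrib)
qed

text \<open>For \<open>u\<close> of weight \<open>p\<close>, \<open>Y[u, w]v = \<Sum>\<^sub>k e\<^bsup>pw\<^esup> (e\<^sup>w - 1)\<^sup>k u\<^bsub>-k-1\<^esub> v\<close>. Multiplying by \<open>e\<^bsup>cw\<^esup>\<close> and
  exchanging the finite sums leaves one residue of exponential type for each \<open>k\<close>.\<close>
lemma bracket_residue_homogeneous:
  assumes u: "u \<in> grade V p"
  shows "bracket_residue V c u v
    = Sum_any (\<lambda>i::nat. scal V ((of_int p + c - 1) gchoose i) (mode V u (int i) v))"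
proof -
  define E where "E = (fps_to_fls (fps_exp (1::complex)) - 1)"
  obtain N where N: "\<forall>k<N. Ycoeff V u v k = 0" using Ycoeff_truncation by blast
  have NE: "\<forall>k<N. \<forall>j. Ycoeff V (exp_L0_coeff V u j) v k = 0"
    using N by (simp add: exp_L0_coeff_homogeneous[OF u] Ycoeff_scale_left)
  \<comment> \<open>Large enough for every \<open>y\<^sup>l\<close> with \<open>l \<le> -1\<close>, the only coefficients that the residue uses.\<close>
  define J where "J = nat (- 1 - N)"
  have J: "- 1 - N \<le> int J" by (simp add: J_def)
  have E0: "fls_nth (E powi k) m = 0" if "m < k" for m k
    using that exp_minus_one_power_nth_eq_0 by (simp add: E_def)
  have coeff: "bracket_coeff V u v l
      = (\<Sum>k\<in>{N..-1}. scal V (fls_nth (fps_to_fls (fps_exp (of_int p)) * E powi k) l) (Ycoeff V u v k))"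
    if l: "l \<le> - 1" for l
  proof -
    have Jl: "l - N \<le> int J" using l J by linarith
    have conv: "fls_nth (fps_to_fls (fps_exp (of_int p)) * E powi k) l
        = (\<Sum>j\<le>J. of_int p ^ j / fact j * fls_nth (E powi k) (l - int j))" if "k \<in> {N..-1}" for k
      using that Jl by (subst fps_times_fls_nth[where J = J]) (auto intro!: E0)
    have "bracket_coeff V u v l = (\<Sum>j\<le>J. \<Sum>k\<in>{N..-1}.
        scal V (fls_nth (E powi k) (l - int j)) (Ycoeff V (exp_L0_coeff V u j) v k))"
      unfolding E_def by (rule bracket_coeff_eq_sum[OF NE Jl l])
    also have "\<dots> = (\<Sum>k\<in>{N..-1}. \<Sum>j\<le>J.
        scal V (of_int p ^ j / fact j * fls_nth (E powi k) (l - int j)) (Ycoeff V u v k))"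
      by (subst sum.swap) (simp add: exp_L0_coeff_homogeneous[OF u] Ycoeff_scale_left mult.commute)
    also have "\<dots> = (\<Sum>k\<in>{N..-1}. scal V (fls_nth (fps_to_fls (fps_exp (of_int p)) * E powi k) l) (Ycoeff V u v k))"
      by (rule sum.cong) (simp_all only: conv scale_sum_left)
    finally show ?thesis .
  qed
  have res: "(\<Sum>j\<le>J. c ^ j / fact j * fls_nth (fps_to_fls (fps_exp (of_int p)) * E powi k) (- 1 - int j))
      = (of_int p + c - 1) gchoose nat (- k - 1)" if k: "k \<in> {N..-1}" for k
  proof -
    have "fls_nth (fps_to_fls (fps_exp (of_int p)) * E powi k) m = 0" if "m < - 1 - int J" for m
      using that k J by (subst fps_times_fls_nth[where J = 0]) (auto intro!: E0)
    then have "(\<Sum>j\<le>J. c ^ j / fact j * fls_nth (fps_to_fls (fps_exp (of_int p)) * E powi k) (- 1 - int j))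
        = fls_nth (fps_to_fls (fps_exp c) * (fps_to_fls (fps_exp (of_int p)) * E powi k)) (- 1)"
      by (subst fps_times_fls_nth[where J = J]) auto
    also have "fps_to_fls (fps_exp c) * (fps_to_fls (fps_exp (of_int p)) * E powi k)
        = fps_to_fls (fps_exp (of_int p + c)) * E powi k"
      by (simp add: fls_times_fps_to_fls fps_exp_add_mult mult_ac)
    finally show ?thesis
      using k by (simp add: E_def residue_exp_minus_one)
  qed
  have "bracket_residue V c u v = (\<Sum>j\<le>J. scal V (c ^ j / fact j) (bracket_coeff V u v (- 1 - int j)))"
    by (rule bracket_residue_eq_sum[OF NE J])
  also have "\<dots> = (\<Sum>k\<in>{N..-1}. \<Sum>j\<le>J. scal V (c ^ j / fact j *
      fls_nth (fps_to_fls (fps_exp (of_int p)) * E powi k) (- 1 - int j)) (Ycoeff V u v k))"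
    by (subst sum.swap) (simp add: coeff scale_sum_right)
  also have "\<dots> = (\<Sum>k\<in>{N..-1}. scal V ((of_int p + c - 1) gchoose nat (- k - 1)) (Ycoeff V u v k))"
    by (rule sum.cong) (simp_all only: res flip: scale_sum_left)
  also have "\<dots> = (\<Sum>i<nat (- N). scal V ((of_int p + c - 1) gchoose i) (mode V u (int i) v))"
    by (rule sum.reindex_bij_witness[where i = "\<lambda>i. - int i - 1" and j = "\<lambda>k. nat (- k - 1)"])
      (auto simp: Ycoeff_def)
  also have "\<dots> = Sum_any (\<lambda>i::nat. scal V ((of_int p + c - 1) gchoose i) (mode V u (int i) v))"
  proof (rule Sum_any.expand_superset[symmetric])
    have "mode V u (int i) v = 0" if "\<not> i < nat (- N)" for i
      using that N[rule_format, of "- int i - 1"] by (simp add: Ycoeff_def)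
    then show "{i. scal V ((of_int p + c - 1) gchoose i) (mode V u (int i) v) \<noteq> 0} \<subseteq> {..<nat (- N)}"
      by force
  qed simp
  finally show ?thesis .
qed

lemma finite_mode: "finite {i::nat. mode V u (int i) v \<noteq> 0}"
proof -
  obtain N where N: "\<forall>n\<ge>N. mode V u n v = 0" using truncation by blast
  have "{i::nat. mode V u (int i) v \<noteq> 0} \<subseteq> {..nat N}"
  proof
    fix i assume "i \<in> {i::nat. mode V u (int i) v \<noteq> 0}"
    then have "\<not> N \<le> int i" using N by auto
    then show "i \<in> {..nat N}" by simp
  qed
  then show ?thesis by (rule finite_subset) simp
qed

text \<open>This is the theorem for single coefficients. Each side is additive in \<open>a\<close> and in \<open>b\<close>;
  additivity of the residue in \<open>b\<close> is read off from its closed form, which is why \<open>a\<close> is made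
  homogeneous first.\<close>
lemma Xcoeff_commutator:
  "Xcoeff V a (Xcoeff V b z n) m - Xcoeff V b (Xcoeff V a z m) n
    = Xcoeff V (bracket_residue V (- of_int m) a b) z (m + n)"
proof (induction a rule: graded_induct)
  case (add a a')
  then show ?case
    by (simp add: Xcoeff_add_left Xcoeff_add_right bracket_residue_add_left algebra_simps)
next
  case (homogeneous p a)
  have fin: "finite {i. scal V (of_int (p - 1 - m) gchoose i) (mode V a (int i) b) \<noteq> 0}" for b
    by (rule finite_subset[OF _ finite_mode[of a b]]) auto
  have residue: "bracket_residue V (- of_int m) a b
      = Sum_any (\<lambda>i::nat. scal V (of_int (p - 1 - m) gchoose i) (mode V a (int i) b))" for b
    using bracket_residue_homogeneous[OF homogeneous, of "- of_int m" b] by (simp add: algebra_simps)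
  show ?case
  proof (induction b rule: graded_induct)
    case (add b b')
    have "bracket_residue V (- of_int m) a (b + b')
        = bracket_residue V (- of_int m) a b + bracket_residue V (- of_int m) a b'"
      unfolding residue by (subst Sum_any.distrib[symmetric, OF fin fin])
        (simp add: mode_add_right scale_right_distrib)
    with add show ?case
      by (simp add: Xcoeff_add_left Xcoeff_add_right algebra_simps)
  next
    case (homogeneous q b)
    note a = \<open>a \<in> grade V p\<close> and b = homogeneous
    let ?S = "{i::nat. mode V a (int i) b \<noteq> 0}"
    have "Xcoeff V (bracket_residue V (- of_int m) a b) z (m + n)
        = Xcoeff V (\<Sum>i\<in>?S. scal V (of_int (p - 1 - m) gchoose i) (mode V a (int i) b)) z (m + n)"
      unfolding residue
      by (rule arg_cong[where f = "\<lambda>v. Xcoeff V v z (m + n)"], rule Sum_any.expand_superset[OF finite_mode]) auto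
    also have "\<dots> = (\<Sum>i\<in>?S. scal V (of_int (p - 1 - m) gchoose i)
        (mode V (mode V a (int i) b) ((p - 1 - m) + (q - 1 - n) - int i) z))"
      unfolding Xcoeff_sum_left Xcoeff_scale_left
      by (intro sum.cong refl) (simp add: Xcoeff_homogeneous[OF mode_in_grade[OF a b]] algebra_simps)
    also have "\<dots> = Sum_any (\<lambda>i::nat. scal V (of_int (p - 1 - m) gchoose i)
        (mode V (mode V a (int i) b) ((p - 1 - m) + (q - 1 - n) - int i) z))"
      by (rule Sum_any.expand_superset[OF finite_mode, symmetric]) auto
    also have "\<dots> = Xcoeff V a (Xcoeff V b z n) m - Xcoeff V b (Xcoeff V a z m) n"
      by (simp only: mode_commutator[symmetric] Xcoeff_homogeneous[OF a] Xcoeff_homogeneous[OF b])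
    finally show ?case by simp
  qed
qed

section \<open>The coefficients of the two sides\<close>

lemma Xcoeff_scale_right: "Xcoeff V u (scal V c z) k = scal V c (Xcoeff V u z k)"
proof (induction u rule: graded_induct)
  case (homogeneous n u)
  then show ?case by (simp add: Xcoeff_homogeneous mode_scale_right)
next
  case (add u v)
  then show ?case by (simp add: scale_right_distrib Xcoeff_add_left)
qed

lemma Xop_zero: "Xop V p 0 z e = 0" "Xop V p u 0 e = 0"
  by (simp_all add: Xop_def fsubst_def)

lemma Xop_nth:
  assumes "w \<noteq> x"
  shows "Xop V (exp_times w x) u z e = (if 0 \<le> e w \<and> (\<forall>v. v \<noteq> w \<and> v \<noteq> x \<longrightarrow> e v = 0)
    then scal V (of_int (e x) ^ nat (e w) / fact (nat (e w))) (Xcoeff V u z (e x)) else 0)"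
proof -
  have "Xop V (exp_times w x) u z e = scal V (exp_times w x (e x) e) (Xcoeff V u z (e x))"
    unfolding Xop_def fsubst_def by (rule Sum_any_single) (simp add: exp_times_nth[OF assms])
  also have "exp_times w x (e x) e = (if 0 \<le> e w \<and> (\<forall>v. v \<noteq> w \<and> v \<noteq> x \<longrightarrow> e v = 0)
    then of_int (e x) ^ nat (e w) / fact (nat (e w)) else 0)"
    unfolding exp_times_nth[OF assms] by simp
  finally show ?thesis
    by (simp only: if_distrib[of "\<lambda>c. scal V c (Xcoeff V u z (e x))"] scale_zero_left)
qed

lemma involves_only_Xop: "w \<noteq> x \<Longrightarrow> involves_only {w, x} (Xop V (exp_times w x) u z)"
  unfolding involves_only_def Xop_nth by simp

lemma fext_Xop:
  assumes "w \<noteq> x" "involves_only Q A" "involves_only R G"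
    "{w, x} \<inter> Q = {}" "{w, x} \<inter> R = {}" "Q \<inter> R = {}"
  shows "fext (Xop V (exp_times w x)) A G e
    = Xop V (exp_times w x) (A (part Q e)) (G (part R e)) (e - part Q e - part R e)"
  using assms by (intro fext_disjoint[where F = "Xop V (exp_times w x)", OF Xop_zero involves_only_Xop])

lemma involves_only_fext_Xop:
  assumes "w \<noteq> x" "involves_only Q A" "involves_only R G"
  shows "involves_only ({w, x} \<union> Q \<union> R) (fext (Xop V (exp_times w x)) A G)"
  using assms by (intro involves_only_fext[where F = "Xop V (exp_times w x)", OF Xop_zero involves_only_Xop])

text \<open>Here both factors are series in the same variable \<open>y\<close>, so the sum over the exponent \<open>j\<close> from
  \<open>e\<^bsup>yL(0)\<^esup> u\<close> remains.\<close>
lemma Ybracket_nth: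
  "Ybracket V y u v e = (if \<forall>w. w \<noteq> y \<longrightarrow> e w = 0 then bracket_coeff V u v (e y) else 0)"
proof -
  define \<phi> where "\<phi> j = (expo y (int j), 0 :: fvar \<Rightarrow> int)" for j
  let ?T = "\<lambda>(d, d'). Yop V (exp_minus_one y) (exp_L0 V y u d) (fconst v d') (e - d - d')"
  have "Ybracket V y u v e = Sum_any ?T"
    by (simp add: Ybracket_def fext_def)
  also have "\<dots> = Sum_any (\<lambda>j. ?T (\<phi> j))"
  proof (rule Sum_any_reindex)
    show "inj \<phi>"
      by (rule injI) (auto simp: \<phi>_def eq_expo_iff expo_nth)
  next
    fix c assume c: "c \<notin> range \<phi>"
    obtain d d' where dd: "c = (d, d')" by (cases c)
    show "?T c = 0"
    proof (cases "d' = 0 \<and> 0 \<le> d y \<and> d = expo y (d y)")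
      case True
      then have "c = \<phi> (nat (d y))" by (simp add: dd \<phi>_def)
      with c show ?thesis by blast
    next
      case False
      then have "exp_L0 V y u d = 0 \<or> fconst v d' = 0"
        by (auto simp: exp_L0_def fconst_def)
      then show ?thesis by (auto simp: dd Yop_zero)
    qed
  qed
  also have "\<dots> = (if \<forall>w. w \<noteq> y \<longrightarrow> e w = 0 then bracket_coeff V u v (e y) else 0)"
  proof -
    have supp: "(\<forall>w. w \<noteq> y \<longrightarrow> (e - expo y m) w = 0) \<longleftrightarrow> (\<forall>w. w \<noteq> y \<longrightarrow> e w = 0)" for m
      by (intro all_cong1) (auto simp: expo_nth)
    have nth: "exp_minus_one y k (e - expo y m) = (if \<forall>w. w \<noteq> y \<longrightarrow> e w = 0
        then fls_nth ((fps_to_fls (fps_exp 1) - 1) powi k) (e y - m) else 0)" for k m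
      unfolding exp_minus_one_def of_fls_def eq_expo_iff supp by (rule if_cong) (simp_all add: expo_nth)
    have L0: "exp_L0 V y u (expo y (int j)) = exp_L0_coeff V u j" for j
      by (simp add: exp_L0_def exp_L0_coeff_def expo_nth)
    have T: "?T (\<phi> j) = Sum_any (\<lambda>k. scal V (exp_minus_one y k (e - expo y (int j)))
        (Ycoeff V (exp_L0_coeff V u j) v k))" for j
      by (simp add: \<phi>_def L0 fconst_0 Yop_def fsubst_def)
    show ?thesis
    proof (cases "\<forall>w. w \<noteq> y \<longrightarrow> e w = 0")
      case True
      then show ?thesis unfolding T nth bracket_coeff_def by simp
    next
      case False
      then show ?thesis unfolding T nth by (simp only: if_False scale_zero_left Sum_any.neutral)
    qed
  qed
  finally show ?thesis .
qed

lemma Ybracket_zero: "Ybracket V y 0 v e = 0" "Ybracket V y u 0 e = 0"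
  by (simp_all add: Ybracket_nth)

lemma involves_only_Ybracket: "involves_only {y} (Ybracket V y u v)"
  unfolding involves_only_def Ybracket_nth by simp

text \<open>The variables are parameters because the commutator contains both orders of the product.\<close>
lemma X_product_nth:
  assumes "distinct [w, x, y, w', x', y']"
  shows "fext (Xop V (exp_times w x)) (Ybracket V y u v)
      (fext (Xop V (exp_times w' x')) (Ybracket V y' u' v') (fconst z)) e
    = (if 0 \<le> e w \<and> 0 \<le> e w' \<and> (\<forall>t. t \<notin> {w, x, y, w', x', y'} \<longrightarrow> e t = 0)
       then scal V (of_int (e x) ^ nat (e w) / fact (nat (e w)) * (of_int (e x') ^ nat (e w') / fact (nat (e w'))))
         (Xcoeff V (bracket_coeff V u v (e y)) (Xcoeff V (bracket_coeff V u' v' (e y')) z (e x')) (e x))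
       else 0)"
proof -
  let ?G = "fext (Xop V (exp_times w' x')) (Ybracket V y' u' v') (fconst z)"
  have inner: "?G e = Xop V (exp_times w' x') (Ybracket V y' u' v' (part {y'} e)) (fconst z (part {} e))
      (e - part {y'} e - part {} e)" for e
    using assms by (intro fext_Xop involves_only_Ybracket involves_only_fconst) auto
  have G: "involves_only ({w', x'} \<union> {y'} \<union> {}) ?G"
    using assms by (intro involves_only_fext_Xop involves_only_Ybracket involves_only_fconst) auto
  have "fext (Xop V (exp_times w x)) (Ybracket V y u v) ?G e
    = Xop V (exp_times w x) (Ybracket V y u v (part {y} e)) (?G (part ({w', x'} \<union> {y'} \<union> {}) e))
      (e - part {y} e - part ({w', x'} \<union> {y'} \<union> {}) e)"
    using assms by (intro fext_Xop involves_only_Ybracket G) auto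
  also have "Ybracket V y u v (part {y} e) = bracket_coeff V u v (e y)"
    by (simp add: Ybracket_nth part_nth)
  also have "?G (part ({w', x'} \<union> {y'} \<union> {}) e) = (if 0 \<le> e w'
      then scal V (of_int (e x') ^ nat (e w') / fact (nat (e w')))
        (Xcoeff V (bracket_coeff V u' v' (e y')) z (e x')) else 0)"
    using assms unfolding inner by (simp add: Ybracket_nth Xop_nth part_nth part_empty fconst_0)
  also have "Xop V (exp_times w x) (bracket_coeff V u v (e y)) (if 0 \<le> e w'
      then scal V (of_int (e x') ^ nat (e w') / fact (nat (e w')))
        (Xcoeff V (bracket_coeff V u' v' (e y')) z (e x')) else 0)
      (e - part {y} e - part ({w', x'} \<union> {y'} \<union> {}) e)
    = (if 0 \<le> e w \<and> 0 \<le> e w' \<and> (\<forall>t. t \<notin> {w, x, y, w', x', y'} \<longrightarrow> e t = 0)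
       then scal V (of_int (e x) ^ nat (e w) / fact (nat (e w)) * (of_int (e x') ^ nat (e w') / fact (nat (e w'))))
         (Xcoeff V (bracket_coeff V u v (e y)) (Xcoeff V (bracket_coeff V u' v' (e y')) z (e x')) (e x))
       else 0)"
  proof -
    have wx: "w \<noteq> x" using assms by simp
    have supp: "(\<forall>t. t \<noteq> w \<and> t \<noteq> x \<longrightarrow> (e - part {y} e - part ({w', x'} \<union> {y'} \<union> {}) e) t = 0)
        \<longleftrightarrow> (\<forall>t. t \<notin> {w, x, y, w', x', y'} \<longrightarrow> e t = 0)"
      using assms by (intro all_cong1) (auto simp: part_nth)
    have val: "(e - part {y} e - part ({w', x'} \<union> {y'} \<union> {}) e) w = e w"
      "(e - part {y} e - part ({w', x'} \<union> {y'} \<union> {}) e) x = e x"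
      using assms by (auto simp: part_nth)
    show ?thesis
    proof (cases "0 \<le> e w'")
      case True
      then show ?thesis
        unfolding Xop_nth[OF wx] supp val by (intro if_cong) (simp_all add: Xcoeff_scale_right)
    next
      case False
      then show ?thesis by (simp add: Xop_zero)
    qed
  qed
  finally show ?thesis .
qed

lemma X_iterate_nth:
  "fext (Xop V (exp_times W2 X2)) (fext (Ybracket V W) (Ybracket V Y1 u1 v1) (Ybracket V Y2 u2 v2)) (fconst z) e
    = (if 0 \<le> e W2 \<and> e X0 = 0 \<and> e X1 = 0 \<and> e W1 = 0
       then scal V (of_int (e X2) ^ nat (e W2) / fact (nat (e W2)))
         (Xcoeff V (bracket_coeff V (bracket_coeff V u1 v1 (e Y1)) (bracket_coeff V u2 v2 (e Y2)) (e W)) z (e X2))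
       else 0)"
proof -
  let ?H = "fext (Ybracket V W) (Ybracket V Y1 u1 v1) (Ybracket V Y2 u2 v2)"
  have inner: "?H e = Ybracket V W (Ybracket V Y1 u1 v1 (part {Y1} e)) (Ybracket V Y2 u2 v2 (part {Y2} e))
      (e - part {Y1} e - part {Y2} e)" for e
    by (intro fext_disjoint[where F = "Ybracket V W" and P = "{W}", OF Ybracket_zero] involves_only_Ybracket) auto
  have H: "involves_only ({W} \<union> {Y1} \<union> {Y2}) ?H"
    by (intro involves_only_fext[where F = "Ybracket V W" and P = "{W}", OF Ybracket_zero] involves_only_Ybracket)
  have "fext (Xop V (exp_times W2 X2)) ?H (fconst z) e
    = Xop V (exp_times W2 X2) (?H (part ({W} \<union> {Y1} \<union> {Y2}) e)) (fconst z (part {} e))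
      (e - part ({W} \<union> {Y1} \<union> {Y2}) e - part {} e)"
    by (intro fext_Xop H involves_only_fconst) auto
  also have "?H (part ({W} \<union> {Y1} \<union> {Y2}) e)
      = bracket_coeff V (bracket_coeff V u1 v1 (e Y1)) (bracket_coeff V u2 v2 (e Y2)) (e W)"
    unfolding inner by (simp add: Ybracket_nth part_nth all_fvar)
  also have "Xop V (exp_times W2 X2) (bracket_coeff V (bracket_coeff V u1 v1 (e Y1)) (bracket_coeff V u2 v2 (e Y2)) (e W))
      (fconst z (part {} e)) (e - part ({W} \<union> {Y1} \<union> {Y2}) e - part {} e)
    = (if 0 \<le> e W2 \<and> e X0 = 0 \<and> e X1 = 0 \<and> e W1 = 0
       then scal V (of_int (e X2) ^ nat (e W2) / fact (nat (e W2)))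
         (Xcoeff V (bracket_coeff V (bracket_coeff V u1 v1 (e Y1)) (bracket_coeff V u2 v2 (e Y2)) (e W)) z (e X2))
       else 0)"
    unfolding part_empty fconst_0 diff_0_right by (simp add: Xop_nth part_nth all_fvar)
  finally show ?thesis .
qed

text \<open>The delta series and the \<open>X\<close> series share \<open>W\<close>, \<open>W2\<close> and \<open>X2\<close>. The exponents of \<open>X1\<close> and \<open>W1\<close> come
  from the delta series alone and fix its index, hence the splitting of \<open>X2\<close>. What remains is a sum
  over the parts \<open>j\<close> of \<open>W\<close> and \<open>s\<close> of \<open>W2\<close> that the delta series takes: the sum over \<open>s\<close> is the
  coefficient of \<open>e\<^bsup>-mw\<^esup> e\<^bsup>(m+n)w\<^esup> = e\<^bsup>nw\<^esup>\<close>, and the sum over \<open>j\<close> is the residue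
  \<open>Res\<^sub>w e\<^bsup>-mw\<^esup> Y[a, w]b\<close>.\<close>
lemma residue_product_nth:
  assumes e: "e W = - 1" and pos: "0 \<le> e W1" "0 \<le> e W2" "e X0 = 0"
  shows "fconv (scal V)
      (fdelta (\<lambda>n. fmult (fexp (of_int (- n)) W) (fmult (exp_times W1 X1 n) (exp_times W2 X2 (- n)))))
      (fext (Xop V (exp_times W2 X2)) (fext (Ybracket V W) (Ybracket V Y1 u1 v1) (Ybracket V Y2 u2 v2)) (fconst z)) e
    = scal V (of_int (e X1) ^ nat (e W1) / fact (nat (e W1)) * (of_int (e X2) ^ nat (e W2) / fact (nat (e W2))))
        (Xcoeff V (bracket_residue V (- of_int (e X1)) (bracket_coeff V u1 v1 (e Y1)) (bracket_coeff V u2 v2 (e Y2)))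
          z (e X1 + e X2))"
proof -
  let ?D = "fdelta (\<lambda>n. fmult (fexp (of_int (- n)) W) (fmult (exp_times W1 X1 n) (exp_times W2 X2 (- n))))"
  let ?K = "fext (Xop V (exp_times W2 X2)) (fext (Ybracket V W) (Ybracket V Y1 u1 v1) (Ybracket V Y2 u2 v2)) (fconst z)"
  define a where "a = bracket_coeff V u1 v1 (e Y1)"
  define b where "b = bracket_coeff V u2 v2 (e Y2)"
  define c where "c = of_int (e X1) ^ nat (e W1) / (fact (nat (e W1)) :: complex)"
  define i where "i = nat (e W2)"
  \<comment> \<open>The monomials of the delta series that can occur as a factor, by their exponents in \<open>W\<close> and \<open>W2\<close>.\<close>
  define \<phi> where "\<phi> = (\<lambda>(j, s). (\<lambda>_. 0)(W := int j, W1 := e W1, X1 := e X1, W2 := int s, X2 := - e X1))"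
  define t where "t j s = scal V ((- of_int (e X1)) ^ j / fact j * (c * ((- of_int (e X1)) ^ s / fact s)))
      (if s \<le> i then scal V (of_int (e X1 + e X2) ^ (i - s) / fact (i - s))
        (Xcoeff V (bracket_coeff V a b (- 1 - int j)) z (e X1 + e X2)) else 0)" for j s
  obtain N where N: "\<forall>k<N. \<forall>j. Ycoeff V (exp_L0_coeff V a j) b k = 0"
    using exp_L0_truncation by blast
  define J where "J = nat (- 1 - N)"
  have J: "- 1 - N \<le> int J" by (simp add: J_def)
  have "fconv (scal V) ?D ?K e = Sum_any (\<lambda>p. scal V (?D (\<phi> p)) (?K (e - \<phi> p)))"
    unfolding fconv_def[of "scal V"]
  proof (rule Sum_any_reindex)
    show "inj \<phi>"
      by (rule injI) (auto simp: \<phi>_def fun_eq_iff all_fvar split: prod.splits)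
  next
    fix d assume d: "d \<notin> range \<phi>"
    show "scal V (?D d) (?K (e - d)) = 0"
    proof (rule ccontr)
      assume "scal V (?D d) (?K (e - d)) \<noteq> 0"
      then have "?D d \<noteq> 0" "?K (e - d) \<noteq> 0" by auto
      note this[unfolded exp_delta_nth X_iterate_nth, THEN if_nonzeroD]
      then have "d = \<phi> (nat (d W), nat (d W2))"
        by (simp add: \<phi>_def fun_eq_iff all_fvar)
      with d show False by blast
    qed
  qed
  also have "\<dots> = Sum_any (\<lambda>(j, s). t j s)"
  proof (rule Sum_any.cong)
    fix p :: "nat \<times> nat"
    obtain j s where p: "p = (j, s)" by (cases p)
    have "?D (\<phi> (j, s)) = (- of_int (e X1)) ^ j / fact j * (c * ((- of_int (e X1)) ^ s / fact s))"
      using pos unfolding exp_delta_nth by (simp add: \<phi>_def c_def)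
    moreover have "?K (e - \<phi> (j, s)) = (if s \<le> i then scal V (of_int (e X1 + e X2) ^ (i - s) / fact (i - s))
        (Xcoeff V (bracket_coeff V a b (- 1 - int j)) z (e X1 + e X2)) else 0)"
    proof -
      have "0 \<le> e W2 - int s \<longleftrightarrow> s \<le> i" "nat (e W2 - int s) = i - s"
        using pos by (auto simp: i_def)
      then show ?thesis
        using e pos unfolding X_iterate_nth by (simp add: \<phi>_def a_def b_def add.commute)
    qed
    ultimately show "scal V (?D (\<phi> p)) (?K (e - \<phi> p)) = (case p of (j, s) \<Rightarrow> t j s)"
      by (simp add: p t_def)
  qed
  also have "\<dots> = (\<Sum>j\<le>J. \<Sum>s\<le>i. t j s)"
  proof (rule Sum_any_prod)
    fix j s assume t: "t j s \<noteq> 0"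
    have "s \<le> i" using t by (auto simp: t_def split: if_splits)
    moreover have "j \<le> J"
    proof (rule ccontr)
      assume "\<not> j \<le> J"
      then have "bracket_coeff V a b (- 1 - int j) = 0"
        using J by (intro bracket_coeff_truncation[OF N]) linarith
      with t show False by (auto simp: t_def split: if_splits)
    qed
    ultimately show "j \<in> {..J} \<and> s \<in> {..i}" by simp
  qed simp_all
  also have "\<dots> = (\<Sum>j\<le>J. scal V (c * (of_int (e X2) ^ i / fact i))
      (Xcoeff V (scal V ((- of_int (e X1)) ^ j / fact j) (bracket_coeff V a b (- 1 - int j))) z (e X1 + e X2)))"
  proof (rule sum.cong[OF refl])
    fix j
    let ?x = "Xcoeff V (bracket_coeff V a b (- 1 - int j)) z (e X1 + e X2)"
    let ?q = "(- of_int (e X1)) ^ j / (fact j :: complex)"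
    have "(\<Sum>s\<le>i. t j s) = (\<Sum>s\<le>i. scal V (?q * c *
        ((- of_int (e X1)) ^ s / fact s * (of_int (e X1 + e X2) ^ (i - s) / fact (i - s)))) ?x)"
      by (rule sum.cong) (simp_all add: t_def mult.assoc)
    also have "\<dots> = scal V (?q * c * (of_int (e X2) ^ i / fact i)) ?x"
      by (simp only: scale_sum_left[symmetric] sum_distrib_left[symmetric] exp_add_coefficient)
        simp
    finally show "(\<Sum>s\<le>i. t j s) = scal V (c * (of_int (e X2) ^ i / fact i))
        (Xcoeff V (scal V ?q (bracket_coeff V a b (- 1 - int j))) z (e X1 + e X2))"
      by (simp add: Xcoeff_scale_left mult_ac)
  qed
  also have "\<dots> = scal V (c * (of_int (e X2) ^ i / fact i))
      (Xcoeff V (bracket_residue V (- of_int (e X1)) a b) z (e X1 + e X2))"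
    by (simp only: bracket_residue_eq_sum[OF N J] Xcoeff_sum_left scale_sum_right)
  finally show ?thesis
    by (simp add: c_def i_def a_def b_def)
qed

lemma residue_product_eq_0:
  assumes "\<not> (0 \<le> e W1 \<and> 0 \<le> e W2 \<and> e X0 = 0)"
  shows "fconv (scal V)
      (fdelta (\<lambda>n. fmult (fexp (of_int (- n)) W) (fmult (exp_times W1 X1 n) (exp_times W2 X2 (- n)))))
      (fext (Xop V (exp_times W2 X2)) (fext (Ybracket V W) (Ybracket V Y1 u1 v1) (Ybracket V Y2 u2 v2)) (fconst z)) e
    = 0"
proof (rule ccontr)
  let ?D = "fdelta (\<lambda>n. fmult (fexp (of_int (- n)) W) (fmult (exp_times W1 X1 n) (exp_times W2 X2 (- n))))"
  let ?K = "fext (Xop V (exp_times W2 X2)) (fext (Ybracket V W) (Ybracket V Y1 u1 v1) (Ybracket V Y2 u2 v2)) (fconst z)"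
  assume "fconv (scal V) ?D ?K e \<noteq> 0"
  then obtain d where "scal V (?D d) (?K (e - d)) \<noteq> 0"
    unfolding fconv_def[of "scal V"] by (rule Sum_any.not_neutral_obtains_not_neutral)
  then have "?D d \<noteq> 0" "?K (e - d) \<noteq> 0" by auto
  note this[unfolded exp_delta_nth X_iterate_nth, THEN if_nonzeroD]
  then show False
    using assms by simp
qed

end

theorem theorem3p3:
  fixes V :: "'v::ab_group_add vertex_data"
    and u1 v1 u2 v2 z :: 'v
  assumes "vertex_operator_algebra V"
  shows
    "fcommutator
       (fext (Xop V (exp_times W1 X1)) (Ybracket V Y1 u1 v1))
       (fext (Xop V (exp_times W2 X2)) (Ybracket V Y2 u2 v2))
       (fconst z)
     = fres W
         (fconv (scal V)
           (fdelta (\<lambda>n. fmult (fexp (of_int (- n)) W)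
                              (fmult (exp_times W1 X1 n) (exp_times W2 X2 (- n)))))
           (fext (Xop V (exp_times W2 X2))
             (fext (Ybracket V W) (Ybracket V Y1 u1 v1) (Ybracket V Y2 u2 v2))
             (fconst z)))"
proof
  interpret vertex_operator_algebra V by fact
  fix e :: "fvar \<Rightarrow> int"
  let ?L = "fcommutator
       (fext (Xop V (exp_times W1 X1)) (Ybracket V Y1 u1 v1))
       (fext (Xop V (exp_times W2 X2)) (Ybracket V Y2 u2 v2))
       (fconst z)"
  let ?R = "fconv (scal V)
           (fdelta (\<lambda>n. fmult (fexp (of_int (- n)) W)
                              (fmult (exp_times W1 X1 n) (exp_times W2 X2 (- n)))))
           (fext (Xop V (exp_times W2 X2))
             (fext (Ybracket V W) (Ybracket V Y1 u1 v1) (Ybracket V Y2 u2 v2))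
             (fconst z))"
  let ?a = "bracket_coeff V u1 v1 (e Y1)" and ?b = "bracket_coeff V u2 v2 (e Y2)"
  let ?c1 = "of_int (e X1) ^ nat (e W1) / (fact (nat (e W1)) :: complex)"
  let ?c2 = "of_int (e X2) ^ nat (e W2) / (fact (nat (e W2)) :: complex)"
  have L: "?L e = (if 0 \<le> e W1 \<and> 0 \<le> e W2 \<and> e X0 = 0 \<and> e W = 0
      then scal V (?c1 * ?c2) (Xcoeff V ?a (Xcoeff V ?b z (e X2)) (e X1)
        - Xcoeff V ?b (Xcoeff V ?a z (e X1)) (e X2)) else 0)"
    by (simp add: fcommutator_def X_product_nth all_fvar scale_right_diff_distrib mult.commute)
  show "?L e = fres W ?R e"
  proof (cases "0 \<le> e W1 \<and> 0 \<le> e W2 \<and> e X0 = 0 \<and> e W = 0")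
    case True
    have "?R (e(W := - 1)) = scal V (?c1 * ?c2)
        (Xcoeff V (bracket_residue V (- of_int (e X1)) ?a ?b) z (e X1 + e X2))"
      using True by (subst residue_product_nth) simp_all
    then show ?thesis
      using True L by (simp add: fres_def Xcoeff_commutator)
  next
    case False
    then have "?R (e(W := - 1)) = 0" if "e W = 0"
      using that by (intro residue_product_eq_0) auto
    then have "fres W ?R e = 0"
      by (cases "e W = 0") (simp_all only: fres_def if_True if_False simp_thms)
    then show ?thesis using L False by simp
  qed
qed

end
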